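(* Let $p$ be a prime and let $R$ be a regular ring of characteristic $p$ such that $R$ is a finitely generated free module over its subring $R^p=\{a^p : a\in R\}$. Then for every ideal $I$ of $R$ there exist an element $f\in R$ and a real number $c>0$ such that $I=\tau(f^c)$.
   Context: Rings are commutative with $1$; regular rings are Noetherian. A ring of characteristic $p$ is one containing $\mathbb{F}_p$. Generalized test ideals. Let $R$ be a regular ring of prime characteristic $p$ that is a finitely generated free module over $R^p$; then $R$ is finitely generated and free over $R^{p^e}=\{a^{p^e}: a\in R\}$ for every $e\ge 1$. For an ideal $J$ of $R$, $J^{[p^e]}$ denotes the ideal generated by $\{u^{p^e}: u\in J\}$. For an ideal $\mathfrak{b}$ of $R$ and $e\ge 1$, $\mathfrak{b}^{[1/p^e]}$ denotes the unique smallest ideal $J$ (with respect to inclusion) such that $\mathfrak{b}\subseteq J^{[p^e]}$. Explicitly: if $u_1,\dots,u_N$ is a basis of $R$ over $R^{p^e}$, $\mathfrak b=(h_1,\dots,h_s)$, and $h_i=\sum_{j=1}^N a_{ij}^{p^e}u_j$ with $a_{ij}\in R$, then $\mathfrak{b}^{[1/p^e]}=(a_{ij}: 1\le i\le s,\ 1\le j\le N)$. For an ideal $\mathfrak a$ of $R$ and a real number $t\ge 0$, the ideals $(\mathfrak a^{\lceil tp^e\rceil})^{[1/p^e]}$ form an increasing sequence in $e$, and the generalized test ideal $\tau(\mathfrak a^t)$ is their stable value, i.e. $\tau(\mathfrak a^t)=(\mathfrak a^{\lceil tp^e\rceil})^{[1/p^e]}$ for $e\gg 0$. For $f\in R$ one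 writes $\tau(f^t)$ for $\tau((f)^t)$. *)

theory Defs
  imports
    "HOL-Algebra.Algebra"
    "HOL-Library.Extended_Nat"
    "HOL-Computational_Algebra.Primes"
    Complex_Main
begin

section \<open>Localization\<close>

text \<open>The fraction \<open>a/s\<close> with respect to a multiplicative set \<open>S\<close>, encoded as the class of all
  pairs \<open>(b, t)\<close> with \<open>u (a t - b s) = 0\<close> for some \<open>u\<close> in \<open>S\<close>.\<close>

definition loc_frac :: "('a, 'b) ring_scheme \<Rightarrow> 'a set \<Rightarrow> 'a \<Rightarrow> 'a \<Rightarrow> ('a \<times> 'a) set" where
  "loc_frac R S a s =
     {(b, t). b \<in> carrier R \<and> t \<in> S \<and>
        (\<exists>u\<in>S. u \<otimes>\<^bsub>R\<^esub> (a \<otimes>\<^bsub>R\<^esub> t \<ominus>\<^bsub>R\<^esub> b \<otimes>\<^bsub>R\<^esub> s) = \<zero>\<^bsub>R\<^esub>)}"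

text \<open>Operations on fractions are independent of the representatives, so that the unions below
  run over a family of equal classes; see \<open>loc_mult_frac\<close> and \<open>loc_add_frac\<close>.\<close>

definition localization :: "('a, 'b) ring_scheme \<Rightarrow> 'a set \<Rightarrow> ('a \<times> 'a) set ring" where
  "localization R S =
     \<lparr> carrier = {loc_frac R S a s | a s. a \<in> carrier R \<and> s \<in> S},
       monoid.mult = (\<lambda>U V. \<Union>(a, s)\<in>U. \<Union>(b, t)\<in>V. loc_frac R S (a \<otimes>\<^bsub>R\<^esub> b) (s \<otimes>\<^bsub>R\<^esub> t)),
       monoid.one = loc_frac R S \<one>\<^bsub>R\<^esub> \<one>\<^bsub>R\<^esub>,
       ring.zero = loc_frac R S \<zero>\<^bsub>R\<^esub> \<one>\<^bsub>R\<^esub>,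
       ring.add = (\<lambda>U V. \<Union>(a, s)\<in>U. \<Union>(b, t)\<in>V.
                loc_frac R S (a \<otimes>\<^bsub>R\<^esub> t \<oplus>\<^bsub>R\<^esub> b \<otimes>\<^bsub>R\<^esub> s) (s \<otimes>\<^bsub>R\<^esub> t)) \<rparr>"

lemma UN_pair_const:
  assumes eq: "\<And>a s b t. (a, s) \<in> A \<Longrightarrow> (b, t) \<in> B \<Longrightarrow> F a s b t = C"
    and A: "(a, s) \<in> A" and B: "(b, t) \<in> B"
  shows "(\<Union>(a, s)\<in>A. \<Union>(b, t)\<in>B. F a s b t) = C"
proof (rule equalityI)
  show "(\<Union>(a, s)\<in>A. \<Union>(b, t)\<in>B. F a s b t) \<subseteq> C"
  proof (intro UN_least)
    fix z assume "z \<in> A"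
    then show "(case z of (a, s) \<Rightarrow> \<Union>(b, t)\<in>B. F a s b t) \<subseteq> C"
      using eq by (cases z) blast
  qed
  have "F a s b t \<subseteq> (\<Union>(a, s)\<in>A. \<Union>(b, t)\<in>B. F a s b t)" using A B by blast
  then show "C \<subseteq> (\<Union>(a, s)\<in>A. \<Union>(b, t)\<in>B. F a s b t)" using eq[OF A B] by simp
qed

locale mult_set = cring R for R (structure) +
  fixes S
  assumes S_sub: "S \<subseteq> carrier R" and S_one: "\<one> \<in> S"
    and S_mult: "s \<in> S \<Longrightarrow> t \<in> S \<Longrightarrow> s \<otimes> t \<in> S"
begin

lemma S_carr [simp]: "s \<in> S \<Longrightarrow> s \<in> carrier R"
  using S_sub by blast

lemma minus_zero_iff: "x \<in> carrier R \<Longrightarrow> y \<in> carrier R \<Longrightarrow> x \<ominus> y = \<zero> \<longleftrightarrow> x = y"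
  by (metis r_right_minus_eq)

lemma loc_frac_mem:
  assumes "a \<in> carrier R" "s \<in> S"
  shows "(b, t) \<in> loc_frac R S a s \<longleftrightarrow>
    b \<in> carrier R \<and> t \<in> S \<and> (\<exists>u\<in>S. u \<otimes> (a \<otimes> t) = u \<otimes> (b \<otimes> s))"
proof -
  have "u \<otimes> (a \<otimes> t \<ominus> b \<otimes> s) = \<zero> \<longleftrightarrow> u \<otimes> (a \<otimes> t) = u \<otimes> (b \<otimes> s)"
    if "u \<in> S" "b \<in> carrier R" "t \<in> S" for u
  proof -
    have "u \<otimes> (a \<otimes> t \<ominus> b \<otimes> s) = u \<otimes> (a \<otimes> t) \<ominus> u \<otimes> (b \<otimes> s)"
      using that assms by (simp add: a_minus_def r_distr r_minus)
    then show ?thesis using that assms by (simp add: minus_zero_iff)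
  qed
  then show ?thesis unfolding loc_frac_def by blast
qed

lemma loc_frac_refl:
  assumes "a \<in> carrier R" "s \<in> S" shows "(a, s) \<in> loc_frac R S a s"
  using assms S_one by (auto simp: loc_frac_mem)

lemma loc_frac_sub:
  assumes "a \<in> carrier R" "s \<in> S" "b \<in> carrier R" "t \<in> S" "u \<in> S"
    and eq: "u \<otimes> (a \<otimes> t) = u \<otimes> (b \<otimes> s)"
  shows "loc_frac R S a s \<subseteq> loc_frac R S b t"
proof
  fix z assume z: "z \<in> loc_frac R S a s"
  obtain c r where cr: "z = (c, r)" by (cases z)
  from z obtain v where v: "c \<in> carrier R" "r \<in> S" "v \<in> S" "v \<otimes> (a \<otimes> r) = v \<otimes> (c \<otimes> s)"
    using assms by (auto simp: loc_frac_mem cr)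
  note cl = assms(1-5) v(1-3) S_carr[OF assms(2)] S_carr[OF assms(4)] S_carr[OF assms(5)]
    S_carr[OF v(2)] S_carr[OF v(3)]
  let ?w = "(u \<otimes> v) \<otimes> s"
  have "?w \<otimes> (b \<otimes> r) = (v \<otimes> r) \<otimes> (u \<otimes> (b \<otimes> s))" using cl by (simp add: m_ac)
  also have "\<dots> = (v \<otimes> r) \<otimes> (u \<otimes> (a \<otimes> t))" by (simp add: eq)
  also have "\<dots> = (u \<otimes> t) \<otimes> (v \<otimes> (a \<otimes> r))" using cl by (simp add: m_ac)
  also have "\<dots> = (u \<otimes> t) \<otimes> (v \<otimes> (c \<otimes> s))" by (simp add: v)
  also have "\<dots> = ?w \<otimes> (c \<otimes> t)" using cl by (simp add: m_ac)
  finally show "z \<in> loc_frac R S b t"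
    using cl S_mult by (auto simp: loc_frac_mem cr intro!: bexI[of _ ?w])
qed

lemma loc_frac_eqI:
  assumes "a \<in> carrier R" "s \<in> S" "b \<in> carrier R" "t \<in> S" "u \<in> S"
    and "u \<otimes> (a \<otimes> t) = u \<otimes> (b \<otimes> s)"
  shows "loc_frac R S a s = loc_frac R S b t"
  using loc_frac_sub[OF assms] loc_frac_sub[OF assms(3,4,1,2,5) assms(6)[symmetric]] by blast

lemma loc_frac_eq_iff:
  assumes "a \<in> carrier R" "s \<in> S" "b \<in> carrier R" "t \<in> S"
  shows "loc_frac R S a s = loc_frac R S b t \<longleftrightarrow> (\<exists>u\<in>S. u \<otimes> (a \<otimes> t) = u \<otimes> (b \<otimes> s))"
proof
  assume "loc_frac R S a s = loc_frac R S b t"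
  then show "\<exists>u\<in>S. u \<otimes> (a \<otimes> t) = u \<otimes> (b \<otimes> s)"
    using loc_frac_refl[OF assms(3,4)] assms by (metis loc_frac_mem)
qed (use assms loc_frac_eqI in blast)

lemma loc_mult_frac:
  assumes "a \<in> carrier R" "s \<in> S" "b \<in> carrier R" "t \<in> S"
  shows "loc_frac R S a s \<otimes>\<^bsub>localization R S\<^esub> loc_frac R S b t = loc_frac R S (a \<otimes> b) (s \<otimes> t)"
proof -
  have *: "loc_frac R S (a' \<otimes> b') (s' \<otimes> t') = loc_frac R S (a \<otimes> b) (s \<otimes> t)"
    if 1: "(a', s') \<in> loc_frac R S a s" and 2: "(b', t') \<in> loc_frac R S b t" for a' s' b' t'
  proof -
    obtain u where u: "a' \<in> carrier R" "s' \<in> S" "u \<in> S" "u \<otimes> (a \<otimes> s') = u \<otimes> (a' \<otimes> s)"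
      using 1 assms by (auto simp: loc_frac_mem)
    obtain v where v: "b' \<in> carrier R" "t' \<in> S" "v \<in> S" "v \<otimes> (b \<otimes> t') = v \<otimes> (b' \<otimes> t)"
      using 2 assms by (auto simp: loc_frac_mem)
    note cl = assms u(1-3) v(1-3) u(2,3)[THEN S_carr] v(2,3)[THEN S_carr] assms(2,4)[THEN S_carr]
    have "(u \<otimes> v) \<otimes> ((a' \<otimes> b') \<otimes> (s \<otimes> t)) = (u \<otimes> (a' \<otimes> s)) \<otimes> (v \<otimes> (b' \<otimes> t))"
      using cl by (simp add: m_ac)
    also have "\<dots> = (u \<otimes> (a \<otimes> s')) \<otimes> (v \<otimes> (b \<otimes> t'))" by (simp add: u v)
    also have "\<dots> = (u \<otimes> v) \<otimes> ((a \<otimes> b) \<otimes> (s' \<otimes> t'))" using cl by (simp add: m_ac)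
    finally have "(u \<otimes> v) \<otimes> ((a' \<otimes> b') \<otimes> (s \<otimes> t)) = (u \<otimes> v) \<otimes> ((a \<otimes> b) \<otimes> (s' \<otimes> t'))" .
    then show ?thesis
      using cl S_mult by (intro loc_frac_eqI[of _ _ _ _ "u \<otimes> v"]) simp_all
  qed
  show ?thesis
    unfolding localization_def monoid.simps ring.simps partial_object.simps
    by (rule UN_pair_const[OF * loc_frac_refl[OF assms(1,2)] loc_frac_refl[OF assms(3,4)]])
qed

lemma loc_add_frac:
  assumes "a \<in> carrier R" "s \<in> S" "b \<in> carrier R" "t \<in> S"
  shows "loc_frac R S a s \<oplus>\<^bsub>localization R S\<^esub> loc_frac R S b t =
    loc_frac R S (a \<otimes> t \<oplus> b \<otimes> s) (s \<otimes> t)"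
proof -
  have *: "loc_frac R S (a' \<otimes> t' \<oplus> b' \<otimes> s') (s' \<otimes> t') = loc_frac R S (a \<otimes> t \<oplus> b \<otimes> s) (s \<otimes> t)"
    if 1: "(a', s') \<in> loc_frac R S a s" and 2: "(b', t') \<in> loc_frac R S b t" for a' s' b' t'
  proof -
    obtain u where u: "a' \<in> carrier R" "s' \<in> S" "u \<in> S" "u \<otimes> (a \<otimes> s') = u \<otimes> (a' \<otimes> s)"
      using 1 assms by (auto simp: loc_frac_mem)
    obtain v where v: "b' \<in> carrier R" "t' \<in> S" "v \<in> S" "v \<otimes> (b \<otimes> t') = v \<otimes> (b' \<otimes> t)"
      using 2 assms by (auto simp: loc_frac_mem)
    note cl = assms u(1-3) v(1-3) u(2,3)[THEN S_carr] v(2,3)[THEN S_carr] assms(2,4)[THEN S_carr]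
    have "(u \<otimes> v) \<otimes> ((a' \<otimes> t' \<oplus> b' \<otimes> s') \<otimes> (s \<otimes> t)) =
        (v \<otimes> t \<otimes> t') \<otimes> (u \<otimes> (a' \<otimes> s)) \<oplus> (u \<otimes> s \<otimes> s') \<otimes> (v \<otimes> (b' \<otimes> t))"
      using cl by (simp add: m_ac l_distr r_distr)
    also have "\<dots> = (v \<otimes> t \<otimes> t') \<otimes> (u \<otimes> (a \<otimes> s')) \<oplus> (u \<otimes> s \<otimes> s') \<otimes> (v \<otimes> (b \<otimes> t'))"
      by (simp add: u v)
    also have "\<dots> = (u \<otimes> v) \<otimes> ((a \<otimes> t \<oplus> b \<otimes> s) \<otimes> (s' \<otimes> t'))"
      using cl by (simp add: m_ac l_distr r_distr)
    finally have "(u \<otimes> v) \<otimes> ((a' \<otimes> t' \<oplus> b' \<otimes> s') \<otimes> (s \<otimes> t)) = (u \<otimes> v) \<otimes> ((a \<otimes> t \<oplus> b \<otimes> s) \<otimes> (s' \<otimes> t'))" .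
    then show ?thesis
      using cl S_mult by (intro loc_frac_eqI[of _ _ _ _ "u \<otimes> v"]) simp_all
  qed
  show ?thesis
    unfolding localization_def monoid.simps ring.simps partial_object.simps
    by (rule UN_pair_const[OF * loc_frac_refl[OF assms(1,2)] loc_frac_refl[OF assms(3,4)]])
qed

lemma loc_carrier: "carrier (localization R S) = {loc_frac R S a s | a s. a \<in> carrier R \<and> s \<in> S}"
  and loc_one: "\<one>\<^bsub>localization R S\<^esub> = loc_frac R S \<one> \<one>"
  and loc_zero: "\<zero>\<^bsub>localization R S\<^esub> = loc_frac R S \<zero> \<one>"
  by (simp_all add: localization_def)

lemma loc_frac_eqI1:
  assumes "a \<in> carrier R" "s \<in> S" "b \<in> carrier R" "t \<in> S" "a \<otimes> t = b \<otimes> s"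
  shows "loc_frac R S a s = loc_frac R S b t"
  using assms S_one loc_frac_eqI[of a s b t \<one>] by simp

lemma loc_cases:
  assumes "U \<in> carrier (localization R S)"
  obtains a s where "U = loc_frac R S a s" "a \<in> carrier R" "s \<in> S"
  using assms unfolding loc_carrier by blast

lemma loc_closed: "a \<in> carrier R \<Longrightarrow> s \<in> S \<Longrightarrow> loc_frac R S a s \<in> carrier (localization R S)"
  unfolding loc_carrier by blast

lemma localization_cring: "cring (localization R S)"
proof (rule cringI)
  let ?L = "localization R S"
  note cl = S_mult S_one loc_closed
  show "abelian_group ?L"
  proof (rule abelian_groupI)
    show "\<zero>\<^bsub>?L\<^esub> \<in> carrier ?L" by (simp add: loc_zero cl)
  next
    fix U V assume "U \<in> carrier ?L" "V \<in> carrier ?L"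
    then show "U \<oplus>\<^bsub>?L\<^esub> V \<in> carrier ?L"
      by (elim loc_cases) (simp add: loc_add_frac cl)
  next
    fix U V W assume "U \<in> carrier ?L" "V \<in> carrier ?L" "W \<in> carrier ?L"
    then show "U \<oplus>\<^bsub>?L\<^esub> V \<oplus>\<^bsub>?L\<^esub> W = U \<oplus>\<^bsub>?L\<^esub> (V \<oplus>\<^bsub>?L\<^esub> W)"
      by (elim loc_cases) (simp add: loc_add_frac cl l_distr r_distr m_ac a_ac)
  next
    fix U V assume "U \<in> carrier ?L" "V \<in> carrier ?L"
    then show "U \<oplus>\<^bsub>?L\<^esub> V = V \<oplus>\<^bsub>?L\<^esub> U"
      by (elim loc_cases) (simp add: loc_add_frac m_comm a_comm)
  next
    fix U assume "U \<in> carrier ?L"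
    then show "\<zero>\<^bsub>?L\<^esub> \<oplus>\<^bsub>?L\<^esub> U = U"
      by (elim loc_cases) (simp add: loc_add_frac loc_zero cl)
  next
    fix U assume "U \<in> carrier ?L"
    then obtain a s where U: "U = loc_frac R S a s" "a \<in> carrier R" "s \<in> S" by (rule loc_cases)
    have "loc_frac R S (\<ominus> a) s \<oplus>\<^bsub>?L\<^esub> U = loc_frac R S \<zero> (s \<otimes> s)"
      using U by (simp add: loc_add_frac l_minus l_neg)
    also have "\<dots> = \<zero>\<^bsub>?L\<^esub>"
      unfolding loc_zero using U by (intro loc_frac_eqI1) (simp_all add: cl)
    finally show "\<exists>V\<in>carrier ?L. V \<oplus>\<^bsub>?L\<^esub> U = \<zero>\<^bsub>?L\<^esub>"
      using U by (intro bexI[of _ "loc_frac R S (\<ominus> a) s"]) (simp_all add: cl)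
  qed
  show "comm_monoid ?L"
  proof (rule comm_monoidI)
    show "\<one>\<^bsub>?L\<^esub> \<in> carrier ?L" by (simp add: loc_one cl)
  next
    fix U V assume "U \<in> carrier ?L" "V \<in> carrier ?L"
    then show "U \<otimes>\<^bsub>?L\<^esub> V \<in> carrier ?L"
      by (elim loc_cases) (simp add: loc_mult_frac cl)
  next
    fix U V W assume "U \<in> carrier ?L" "V \<in> carrier ?L" "W \<in> carrier ?L"
    then show "U \<otimes>\<^bsub>?L\<^esub> V \<otimes>\<^bsub>?L\<^esub> W = U \<otimes>\<^bsub>?L\<^esub> (V \<otimes>\<^bsub>?L\<^esub> W)"
      by (elim loc_cases) (simp add: loc_mult_frac cl m_assoc)
  next
    fix U V assume "U \<in> carrier ?L" "V \<in> carrier ?L"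
    then show "U \<otimes>\<^bsub>?L\<^esub> V = V \<otimes>\<^bsub>?L\<^esub> U"
      by (elim loc_cases) (simp add: loc_mult_frac m_comm)
  next
    fix U assume "U \<in> carrier ?L"
    then show "\<one>\<^bsub>?L\<^esub> \<otimes>\<^bsub>?L\<^esub> U = U"
      by (elim loc_cases) (simp add: loc_mult_frac loc_one cl)
  qed
  fix U V W assume "U \<in> carrier ?L" "V \<in> carrier ?L" "W \<in> carrier ?L"
  then obtain a s b t c r where
    "U = loc_frac R S a s" "V = loc_frac R S b t" "W = loc_frac R S c r"
    and abc: "a \<in> carrier R" "b \<in> carrier R" "c \<in> carrier R" "s \<in> S" "t \<in> S" "r \<in> S"
    by (elim loc_cases)
  moreover have "loc_frac R S ((a \<otimes> t \<oplus> b \<otimes> s) \<otimes> c) (s \<otimes> t \<otimes> r) =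
      loc_frac R S ((a \<otimes> c) \<otimes> (t \<otimes> r) \<oplus> (b \<otimes> c) \<otimes> (s \<otimes> r)) ((s \<otimes> r) \<otimes> (t \<otimes> r))"
    using abc by (intro loc_frac_eqI1) (simp_all add: cl l_distr r_distr m_ac)
  ultimately show "(U \<oplus>\<^bsub>?L\<^esub> V) \<otimes>\<^bsub>?L\<^esub> W = U \<otimes>\<^bsub>?L\<^esub> W \<oplus>\<^bsub>?L\<^esub> V \<otimes>\<^bsub>?L\<^esub> W"
    by (simp add: loc_add_frac loc_mult_frac cl)
qed

end

section \<open>Regular rings\<close>

definition krull_dim :: "('a, 'b) ring_scheme \<Rightarrow> enat" where
  "krull_dim R =
     Sup {enat n | n. \<exists>P. (\<forall>i\<le>n. primeideal (P i) R) \<and> (\<forall>i<n. P i \<subset> P (Suc i))}"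

definition regular_local_ring :: "('a, 'b) ring_scheme \<Rightarrow> bool" where
  "regular_local_ring R \<longleftrightarrow> cring R \<and> noetherian_ring R \<and>
     (\<exists>M. maximalideal M R \<and> (\<forall>M'. maximalideal M' R \<longrightarrow> M' = M) \<and>
        (\<exists>U \<subseteq> carrier R. finite U \<and> enat (card U) = krull_dim R \<and> M = Idl\<^bsub>R\<^esub> U))"

definition regular_ring :: "('a, 'b) ring_scheme \<Rightarrow> bool" where
  "regular_ring R \<longleftrightarrow> cring R \<and> noetherian_ring R \<and>
     (\<forall>P. primeideal P R \<longrightarrow> regular_local_ring (localization R (carrier R - P)))"

lemma (in primeideal) mult_set_compl: "mult_set R (carrier R - I)"
proof -
  have "\<one> \<notin> I" using I_notcarr one_imp_carrier by blast
  then show ?thesis using I_prime by unfold_locales auto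
qed

section \<open>Characteristic and freeness over the subring of powers\<close>

text \<open>For prime \<open>p\<close> this says that the prime subring of \<open>R\<close> is the field with \<open>p\<close> elements; in
  particular \<open>R\<close> is not the zero ring.\<close>

definition has_characteristic :: "('a, 'b) ring_scheme \<Rightarrow> nat \<Rightarrow> bool" where
  "has_characteristic R p \<longleftrightarrow> (\<forall>n::nat. [n] \<cdot>\<^bsub>R\<^esub> \<one>\<^bsub>R\<^esub> = \<zero>\<^bsub>R\<^esub> \<longleftrightarrow> p dvd n)"

definition power_subring :: "('a, 'b) ring_scheme \<Rightarrow> nat \<Rightarrow> 'a set" where
  "power_subring R q = {a [^]\<^bsub>R\<^esub> q | a. a \<in> carrier R}"

definition finite_free_over :: "('a, 'b) ring_scheme \<Rightarrow> 'a set \<Rightarrow> bool" where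
  "finite_free_over R K \<longleftrightarrow>
     (\<exists>us. set us \<subseteq> carrier R \<and>
        (\<forall>x\<in>carrier R. \<exists>!ks. length ks = length us \<and> set ks \<subseteq> K \<and> x = ring.combine R ks us))"

section \<open>Generalized test ideals\<close>

definition frob_power :: "('a, 'b) ring_scheme \<Rightarrow> nat \<Rightarrow> 'a set \<Rightarrow> 'a set" where
  "frob_power R q J = Idl\<^bsub>R\<^esub> {u [^]\<^bsub>R\<^esub> q | u. u \<in> J}"

definition is_frob_root :: "('a, 'b) ring_scheme \<Rightarrow> nat \<Rightarrow> 'a set \<Rightarrow> 'a set \<Rightarrow> bool" where
  "is_frob_root R q B J \<longleftrightarrow> ideal J R \<and> B \<subseteq> frob_power R q J \<and>
     (\<forall>J'. ideal J' R \<and> B \<subseteq> frob_power R q J' \<longrightarrow> J \<subseteq> J')"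

definition frob_root :: "('a, 'b) ring_scheme \<Rightarrow> nat \<Rightarrow> 'a set \<Rightarrow> 'a set" where
  "frob_root R q B = (THE J. is_frob_root R q B J)"

lemma frob_root_eqI: "is_frob_root R q B J \<Longrightarrow> frob_root R q B = J"
  unfolding frob_root_def is_frob_root_def by (rule the_equality) blast+

text \<open>Powers of ideals are powers in the library's multiplicative monoid \<open>ideals_set R\<close>.\<close>

definition test_ideal :: "('a, 'b) ring_scheme \<Rightarrow> nat \<Rightarrow> 'a set \<Rightarrow> real \<Rightarrow> 'a set" where
  "test_ideal R p A t =
     (THE J. \<forall>\<^sub>F e in sequentially.
        frob_root R (p ^ e) (A [^]\<^bsub>ideals_set R\<^esub> nat \<lceil>t * real (p ^ e)\<rceil>) = J)"

lemma test_ideal_eqI: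
  assumes "\<forall>\<^sub>F e in sequentially.
      frob_root R (p ^ e) (A [^]\<^bsub>ideals_set R\<^esub> nat \<lceil>t * real (p ^ e)\<rceil>) = J"
  shows "test_ideal R p A t = J"
  unfolding test_ideal_def
proof (rule the_equality)
  show "\<forall>\<^sub>F e in sequentially.
      frob_root R (p ^ e) (A [^]\<^bsub>ideals_set R\<^esub> nat \<lceil>t * real (p ^ e)\<rceil>) = J"
    by (rule assms)
next
  fix J' assume "\<forall>\<^sub>F e in sequentially.
      frob_root R (p ^ e) (A [^]\<^bsub>ideals_set R\<^esub> nat \<lceil>t * real (p ^ e)\<rceil>) = J'"
  with assms have "\<forall>\<^sub>F e in sequentially. J' = J" by eventually_elim simp
  then show "J' = J" by simp
qed

end

theory Submission
  imports Defs
begin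

text \<open>For \<open>q = p\<^sup>e\<close> one has \<open>\<tau>(f\<^bsup>1/q\<^esup>) = (f)\<^bsup>[1/q]\<^esup>\<close>, so it suffices to find \<open>f\<close> and \<open>e\<close> such that an ideal
  \<open>J\<close> contains \<open>I\<close> exactly when \<open>f \<in> J\<^bsup>[q]\<^esup>\<close>. By freeness, \<open>\<Sum> c\<^sub>i\<^sup>p u\<^sub>i \<in> J\<^bsup>[p]\<^esup>\<close> is equivalent to
  \<open>c\<^sub>i \<in> J\<close> for all \<open>i\<close>. If the rank of \<open>R\<close> over \<open>R\<^sup>p\<close> is at least 2, generators of \<open>I\<close> can thus be
  packed one at a time into the coordinates of a single element. If the rank is at most 1, Frobenius
  is surjective, \<open>R\<close> is von Neumann regular and \<open>I\<close> is principal.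

  All this needs Frobenius to be injective. Regularity enters only through the localizations at
  minimal primes, which are fields: together with freeness this shows that the coordinates of a
  nilpotent element are nilpotent, which forces the nilradical to vanish.\<close>

section \<open>Frobenius and Frobenius powers\<close>

context cring
begin

lemma ideal_if_closed:
  assumes "J \<subseteq> carrier R" "\<zero> \<in> J"
    and "\<And>x y. x \<in> J \<Longrightarrow> y \<in> J \<Longrightarrow> x \<oplus> y \<in> J"
    and l: "\<And>r x. r \<in> carrier R \<Longrightarrow> x \<in> J \<Longrightarrow> r \<otimes> x \<in> J"
  shows "ideal J R"
proof (rule idealI[OF ring_axioms])
  have minv: "\<ominus> x \<in> J" if "x \<in> J" for x
    using l[of "\<ominus> \<one>" x] that assms(1) by (auto simp: l_minus subset_eq)
  have "inv\<^bsub>add_monoid R\<^esub> x \<in> J" if "x \<in> J" for x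
    using minv[OF that] by (simp add: a_inv_def)
  then show "subgroup J (add_monoid R)"
    using assms by unfold_locales auto
  show "x \<otimes> a \<in> J" "a \<otimes> x \<in> J" if "a \<in> J" "x \<in> carrier R" for a x
    using l[OF that(2,1)] that assms(1) by (auto simp: m_comm subset_eq)
qed

lemma combine_in_ideal:
  assumes "ideal J R" "set ks \<subseteq> J" "set us \<subseteq> carrier R"
  shows "combine ks us \<in> J"
proof -
  interpret J: ideal J R by fact
  show ?thesis
    using assms(2,3)
    by (induct ks us rule: combine.induct)
      (auto intro: J.I_r_closed J.a_closed)
qed

lemma binomial_expansion:
  fixes n :: nat
  assumes x: "x \<in> carrier R" and y: "y \<in> carrier R"
  shows "(x \<oplus> y) [^] n = (\<Oplus>k\<in>{..n}. add_pow R (n choose k) (x [^] k \<otimes> y [^] (n - k)))"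
proof (induction n)
  case 0
  then show ?case by simp
next
  case (Suc n)
  let ?m = "\<lambda>k. x [^] k \<otimes> y [^] (Suc n - k)"
  let ?t = "\<lambda>k. x [^] k \<otimes> y [^] (n - k)"
  have c: "?m k \<in> carrier R" "?t k \<in> carrier R" for k using x y by simp_all
  have mx: "x \<otimes> (add_pow R (n choose k) (?t k)) = add_pow R (n choose k) (?m (Suc k))" for k
  proof -
    have "x \<otimes> (add_pow R (n choose k) (?t k)) = add_pow R (n choose k) (x \<otimes> ?t k)"
      using x y by (simp add: add_pow_rdistr)
    also have "x \<otimes> ?t k = ?m (Suc k)" using x y by (simp add: m_ac)
    finally show ?thesis .
  qed
  have my: "y \<otimes> (add_pow R (n choose k) (?t k)) = add_pow R (n choose k) (?m k)" if "k \<le> n" for k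
  proof -
    have "y \<otimes> (add_pow R (n choose k) (?t k)) = add_pow R (n choose k) (y \<otimes> ?t k)"
      using x y by (simp add: add_pow_rdistr)
    also have "y \<otimes> ?t k = ?m k" using x y that by (simp add: m_ac Suc_diff_le)
    finally show ?thesis .
  qed
  have "(x \<oplus> y) [^] Suc n = (x \<oplus> y) \<otimes> (\<Oplus>k\<in>{..n}. add_pow R (n choose k) (?t k))"
    using x y by (simp add: Suc.IH m_comm)
  also have "\<dots> = (\<Oplus>k\<in>{..n}. x \<otimes> (add_pow R (n choose k) (?t k))) \<oplus> (\<Oplus>k\<in>{..n}. y \<otimes> (add_pow R (n choose k) (?t k)))"
    using x y by (simp add: l_distr finsum_rdistr)
  also have "\<dots> = (\<Oplus>k\<in>{..n}. add_pow R (n choose k) (?m (Suc k))) \<oplus> (\<Oplus>k\<in>{..n}. add_pow R (n choose k) (?m k))"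
    unfolding mx using c by (intro arg_cong2[of _ _ _ _ "(\<oplus>)"] finsum_cong' refl my) auto
  \<comment> \<open>The added top term vanishes because \<open>n choose Suc n = 0\<close>. Splitting
    off \<open>k = 0\<close> afterwards indexes both sums by \<open>Suc k\<close>, ready for
    Pascal's rule.\<close>
  also have "(\<Oplus>k\<in>{..n}. add_pow R (n choose k) (?m k)) = (\<Oplus>k\<in>{..Suc n}. add_pow R (n choose k) (?m k))"
    using c by (subst finsum_Suc) (auto simp: binomial_eq_0)
  also have "\<dots> = (\<Oplus>k\<in>{..n}. add_pow R (n choose Suc k) (?m (Suc k))) \<oplus> add_pow R (n choose 0) (?m 0)"
    using c by (subst finsum_Suc2) auto
  also have "(\<Oplus>k\<in>{..n}. add_pow R (n choose k) (?m (Suc k))) \<oplus>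
      ((\<Oplus>k\<in>{..n}. add_pow R (n choose Suc k) (?m (Suc k))) \<oplus> add_pow R (n choose 0) (?m 0)) =
      (\<Oplus>k\<in>{..n}. add_pow R (n choose k) (?m (Suc k)) \<oplus> add_pow R (n choose Suc k) (?m (Suc k))) \<oplus> add_pow R (n choose 0) (?m 0)"
    using c x y by (subst finsum_addf) (auto simp: a_assoc)
  also have "\<dots> = (\<Oplus>k\<in>{..n}. add_pow R (Suc n choose Suc k) (?m (Suc k))) \<oplus> add_pow R (Suc n choose 0) (?m 0)"
    using c by (simp only: add.nat_pow_mult binomial_Suc_Suc binomial_n_0)
  also have "\<dots> = (\<Oplus>k\<in>{..Suc n}. add_pow R (Suc n choose k) (?m k))"
    using c by (subst finsum_Suc2) auto
  finally show ?case .
qed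

end

section \<open>Additivity of Frobenius in characteristic p\<close>

locale char_p_ring = cring R for R (structure) +
  fixes p :: nat
  assumes p_prime: "Factorial_Ring.prime p" and char_p: "add_pow R p \<one> = \<zero>"
begin

lemma p_gt_1: "p > 1"
  using p_prime by (rule prime_gt_1_nat)

lemma zero_pow_p [simp]: "\<zero> [^] p = \<zero>"
  using p_gt_1 by (simp add: nat_pow_zero)

lemma add_pow_eq_zero:
  assumes "p dvd n" "x \<in> carrier R"
  shows "add_pow R n x = \<zero>"
proof -
  obtain m where n: "n = p * m" using assms(1) ..
  have "add_pow R n x = add_pow R m ((add_pow R p \<one>) \<otimes> x)"
    using assms(2) by (simp add: n add_pow_ldistr add.nat_pow_pow)
  then show ?thesis using assms(2) by (simp add: char_p)
qed

text \<open>The inner binomial coefficients are divisible by \<open>p\<close>, so only the two end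
  terms of the expansion survive.\<close>

lemma frob_add:
  assumes x: "x \<in> carrier R" and y: "y \<in> carrier R"
  shows "(x \<oplus> y) [^] p = x [^] p \<oplus> y [^] p"
proof -
  let ?f = "\<lambda>k. add_pow R (p choose k) (x [^] k \<otimes> y [^] (p - k))"
  \<comment> \<open>As \<open>p\<close> is at least 2, both ends \<open>k = 0\<close> and
    \<open>k = p\<close> can be split off, leaving the indices \<open>Suc k\<close> with
    \<open>k \<le> m\<close>.\<close>
  obtain m where m: "p = Suc (Suc m)"
    using p_gt_1 by (metis Suc_lessE less_numeral_extra(4) One_nat_def not0_implies_Suc not_one_less_zero)
  have 0: "?f (Suc k) = \<zero>" if "k \<in> {..m}" for k
    using that x y m dvd_choose_prime[of "Suc k" p] p_prime
    by (intro add_pow_eq_zero) auto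
  have "(x \<oplus> y) [^] p = (\<Oplus>k\<in>{..Suc (Suc m)}. ?f k)"
    using binomial_expansion[OF x y, of p] by (simp add: m)
  also have "\<dots> = ?f p \<oplus> ((\<Oplus>k\<in>{..m}. ?f (Suc k)) \<oplus> ?f 0)"
    using x y by (subst finsum_Suc, simp, subst finsum_Suc2) (auto simp: m)
  also have "(\<Oplus>k\<in>{..m}. ?f (Suc k)) = (\<Oplus>k\<in>{..m}. \<zero>)"
    by (rule finsum_cong') (use 0 in auto)
  finally show ?thesis using x y by simp
qed

text \<open>Frobenius is additive and multiplicative. As Frobenius powers are given by generators,
  this allows a statement about \<open>p\<close>-th powers of their elements to be checked on
  generators.\<close>

lemma ideal_frob_vimage:
  assumes "ideal J R"
  shows "ideal {x \<in> carrier R. x [^] p \<in> J} R"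
proof -
  interpret J: ideal J R by fact
  show ?thesis
    by (rule ideal_if_closed)
      (auto simp: frob_add nat_pow_distrib intro: J.I_l_closed)
qed

lemma ideal_frob_kernel: "ideal {x \<in> carrier R. x [^] (p ^ e) = \<zero>} R"
proof (induction e)
  case 0
  have "{x \<in> carrier R. x [^] (p ^ 0) = \<zero>} = {\<zero>}" by auto
  then show ?case by (simp add: zeroideal)
next
  case (Suc e)
  have "{x \<in> carrier R. x [^] (p ^ Suc e) = \<zero>} =
      {x \<in> carrier R. x [^] p \<in> {x \<in> carrier R. x [^] (p ^ e) = \<zero>}}"
    by (auto simp: nat_pow_pow)
  then show ?case using ideal_frob_vimage[OF Suc.IH] by simp
qed

section \<open>Frobenius powers of ideals\<close>

lemma frob_power_ideal:
  assumes "ideal J R"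
  shows "ideal (frob_power R q J) R"
proof -
  interpret J: ideal J R by fact
  show ?thesis unfolding frob_power_def by (rule genideal_ideal) auto
qed

lemma pow_in_frob_power:
  assumes "ideal J R" "x \<in> J"
  shows "x [^] q \<in> frob_power R q J"
proof -
  interpret J: ideal J R by fact
  show ?thesis unfolding frob_power_def
    using assms(2) by (intro subsetD[OF genideal_self]) auto
qed

lemma frob_power_subset:
  assumes "ideal K R" "\<And>x. x \<in> J \<Longrightarrow> x [^] q \<in> K"
  shows "frob_power R q J \<subseteq> K"
  unfolding frob_power_def using assms by (intro genideal_minimal) auto

lemma frob_power_one:
  assumes "ideal J R"
  shows "frob_power R 1 J = J"
proof -
  interpret J: ideal J R by fact
  have "frob_power R 1 J \<subseteq> J"
    by (rule frob_power_subset[OF assms]) simp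
  moreover have "J \<subseteq> frob_power R 1 J"
  proof
    fix x assume x: "x \<in> J"
    from pow_in_frob_power[OF assms x, of 1] x
    show "x \<in> frob_power R 1 J" by simp
  qed
  ultimately show ?thesis by blast
qed

lemma frob_power_frob_power:
  assumes J: "ideal J R"
  shows "frob_power R p (frob_power R q J) = frob_power R (q * p) J"
proof
  interpret J: ideal J R by fact
  have I: "ideal (frob_power R q J) R" using J by (rule frob_power_ideal)
  have I': "ideal (frob_power R (q * p) J) R" using J by (rule frob_power_ideal)
  show "frob_power R (q * p) J \<subseteq> frob_power R p (frob_power R q J)"
  proof (rule frob_power_subset)
    fix x assume x: "x \<in> J"
    show "x [^] (q * p) \<in> frob_power R p (frob_power R q J)"
      using pow_in_frob_power[OF I pow_in_frob_power[OF J x]] x by (simp add: nat_pow_pow)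
  qed (rule frob_power_ideal[OF I])
  \<comment> \<open>The right-hand side is an ideal, so it is enough to test the generators of the
    left-hand side.\<close>
  have "frob_power R q J \<subseteq> {x \<in> carrier R. x [^] p \<in> frob_power R (q * p) J}"
  proof (rule frob_power_subset)
    fix x assume x: "x \<in> J"
    show "x [^] q \<in> {x \<in> carrier R. x [^] p \<in> frob_power R (q * p) J}"
      using pow_in_frob_power[OF J x, of "q * p"] x by (simp add: nat_pow_pow)
  qed (rule ideal_frob_vimage[OF I'])
  then show "frob_power R p (frob_power R q J) \<subseteq> frob_power R (q * p) J"
    by (intro frob_power_subset[OF I']) blast
qed

end

section \<open>Minimal primes of regular rings\<close>

lemma (in mult_set) loc_frac_eq_zero_iff:
  assumes "a \<in> carrier R" "s \<in> S"
  shows "loc_frac R S a s = \<zero>\<^bsub>localization R S\<^esub> \<longleftrightarrow> (\<exists>u\<in>S. u \<otimes> a = \<zero>)"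
  unfolding loc_zero using assms S_one by (subst loc_frac_eq_iff) auto

lemma (in mult_set) S_pow:
  fixes n :: nat
  assumes "s \<in> S"
  shows "s [^] n \<in> S"
  using assms S_one S_mult by (induction n) auto

lemma (in mult_set) loc_frac_pow:
  fixes n :: nat
  assumes "a \<in> carrier R" "s \<in> S"
  shows "loc_frac R S a s [^]\<^bsub>localization R S\<^esub> n = loc_frac R S (a [^] n) (s [^] n)"
  using assms by (induction n) (simp_all add: loc_one loc_mult_frac S_pow)

lemma (in primeideal) pow_mem_imp_mem:
  fixes n :: nat
  assumes "a \<in> carrier R" "a [^] n \<in> I"
  shows "a \<in> I"
  using assms(2)
proof (induction n)
  case 0
  then show ?case using I_notcarr one_imp_carrier by auto
next
  case (Suc n)
  then show ?case using I_prime[of "a [^] n" a] assms(1) by auto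
qed

text \<open>Only chains of positive length have to be excluded: the supremum of the empty set is
  \<open>0\<close> in \<open>enat\<close>, so no prime ideal has to be exhibited.\<close>

lemma krull_dim_eq_0:
  assumes "\<And>P Q. primeideal P R \<Longrightarrow> primeideal Q R \<Longrightarrow> \<not> P \<subset> Q"
  shows "krull_dim R = 0"
proof -
  have "n = 0" if "\<forall>i\<le>n. primeideal (P i) R" "\<forall>i<n. P i \<subset> P (Suc i)" for n and P :: "nat \<Rightarrow> _"
    using that assms[of "P 0" "P (Suc 0)"] by (cases n) auto
  then have "{enat n | n. \<exists>P. (\<forall>i\<le>n. primeideal (P i) R) \<and> (\<forall>i<n. P i \<subset> P (Suc i))} \<subseteq> {0}"
    by (auto simp: zero_enat_def)
  then have "krull_dim R \<le> 0" unfolding krull_dim_def by (intro Sup_least) auto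
  then show ?thesis by simp
qed

text \<open>If every element of the prime ideal \<open>P\<close> becomes nilpotent in the localization at \<open>P\<close>, that
  localization has dimension 0, so its maximal ideal is generated by the empty set.\<close>

lemma (in cring) regular_ring_minimal_prime:
  assumes reg: "regular_ring R" and P: "primeideal P R"
    and nil: "\<And>a. a \<in> P \<Longrightarrow> \<exists>s\<in>carrier R - P. \<exists>n::nat. s \<otimes> a [^] n = \<zero>"
    and a: "a \<in> P"
  shows "\<exists>s\<in>carrier R - P. s \<otimes> a = \<zero>"
proof -
  interpret P: primeideal P R by fact
  define S where "S = carrier R - P"
  interpret mult_set R S unfolding S_def by (rule P.mult_set_compl)
  let ?L = "localization R S"
  interpret L: cring ?L by (rule localization_cring)
  \<comment> \<open>Fractions with numerator in \<open>P\<close> are nilpotent and hence lie in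
    every prime ideal.\<close>
  have nilL: "loc_frac R S b s \<in> Q" if bP: "b \<in> P" and s: "s \<in> S" and Q: "primeideal Q ?L" for b s Q
  proof -
    interpret Q: primeideal Q ?L by fact
    have b: "b \<in> carrier R" using that(1) by (rule P.Icarr)
    obtain u and n :: nat where u: "u \<in> S" "u \<otimes> b [^] n = \<zero>"
      using nil[OF bP] unfolding S_def by blast
    have "loc_frac R S b s [^]\<^bsub>?L\<^esub> n = \<zero>\<^bsub>?L\<^esub>"
      using loc_frac_eq_zero_iff[OF nat_pow_closed[OF b] S_pow[OF that(2)]] u
      unfolding loc_frac_pow[OF b that(2)] by blast
    then have "loc_frac R S b s [^]\<^bsub>?L\<^esub> n \<in> Q"
      by (simp only: additive_subgroup.zero_closed[OF Q.is_additive_subgroup])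
    then show ?thesis by (rule Q.pow_mem_imp_mem[OF loc_closed[OF b that(2)]])
  qed
  \<comment> \<open>A fraction in \<open>Q2\<close> but not in \<open>Q1\<close> has its numerator
    outside \<open>P\<close> by \<open>nilL\<close>, so it is a unit and \<open>Q2\<close> would be
    the whole ring.\<close>
  have "\<not> Q1 \<subset> Q2" if Q: "primeideal Q1 ?L" "primeideal Q2 ?L" for Q1 Q2
  proof
    interpret Q2: primeideal Q2 ?L by fact
    assume "Q1 \<subset> Q2"
    then obtain U where U: "U \<in> Q2" "U \<notin> Q1" by blast
    then obtain b s where b: "U = loc_frac R S b s" "b \<in> carrier R" "s \<in> S"
      using loc_cases[OF Q2.Icarr[OF U(1)]] by blast
    have "b \<notin> P" using nilL[OF _ b(3) Q(1)] U(2) b(1) by metis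
    then have bS: "b \<in> S" using b(2) unfolding S_def by blast
    have "loc_frac R S (b \<otimes> s) (s \<otimes> b) = loc_frac R S \<one> \<one>"
      by (rule loc_frac_eqI1) (use b(2,3) bS S_one in \<open>simp_all add: S_mult m_comm\<close>)
    then have "U \<otimes>\<^bsub>?L\<^esub> loc_frac R S s b = \<one>\<^bsub>?L\<^esub>"
      unfolding b(1) loc_one loc_mult_frac[OF b(2,3) S_carr[OF b(3)] bS] .
    then have "\<one>\<^bsub>?L\<^esub> \<in> Q2"
      using Q2.I_r_closed[OF U(1) loc_closed[OF S_carr[OF b(3)] bS]] by metis
    then show False using Q2.one_imp_carrier Q2.I_notcarr by blast
  qed
  then have "krull_dim ?L = 0" by (rule krull_dim_eq_0)
  moreover have "regular_local_ring ?L" using reg P unfolding regular_ring_def S_def by blast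
  \<comment> \<open>The generating set has as many elements as the dimension, that is, none. Its
    finiteness is kept because \<open>card\<close> is \<open>0\<close> for infinite sets as
    well.\<close>
  ultimately obtain M U where M: "maximalideal M ?L" and U: "finite U" "card U = 0" "M = Idl\<^bsub>?L\<^esub> U"
    unfolding regular_local_ring_def by (metis enat_0_iff(1))
  then have "M = Idl\<^bsub>?L\<^esub> {}" by (metis card_0_eq)
  then have "M \<subseteq> {\<zero>\<^bsub>?L\<^esub>}" using L.genideal_minimal[OF L.zeroideal] by blast
  \<comment> \<open>\<open>M\<close> is maximal, hence prime, so \<open>nilL\<close> puts the image
    of \<open>a\<close> into \<open>M\<close>, which is the zero ideal.\<close>
  then have "loc_frac R S a \<one> = \<zero>\<^bsub>?L\<^esub>"
    using nilL[OF a S_one L.maximalideal_prime[OF M]] by blast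
  then have "\<exists>u\<in>S. u \<otimes> a = \<zero>"
    using loc_frac_eq_zero_iff[OF P.Icarr[OF a] S_one] by simp
  then show ?thesis by (simp add: S_def)
qed

text \<open>The complement of a maximal multiplicative set that contains \<open>c\<close> and not \<open>0\<close> is a minimal
  prime ideal.\<close>

lemma (in cring) exists_minimal_prime:
  assumes c: "c \<in> carrier R" and nil: "\<And>n::nat. c [^] n \<noteq> \<zero>"
  obtains P where "primeideal P R" "c \<notin> P"
    "\<And>a. a \<in> P \<Longrightarrow> \<exists>s\<in>carrier R - P. \<exists>n::nat. s \<otimes> a [^] n = \<zero>"
proof -
  define \<A> where "\<A> = {S. mult_set R S \<and> c \<in> S \<and> \<zero> \<notin> S}"
  have "range (\<lambda>n::nat. c [^] n) \<in> \<A>"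
  proof -
    have "mult_set R (range (\<lambda>n::nat. c [^] n))"
    proof (intro mult_set.intro mult_set_axioms.intro is_cring)
      show "range (\<lambda>n::nat. c [^] n) \<subseteq> carrier R" using c by auto
      show "\<one> \<in> range (\<lambda>n::nat. c [^] n)" by (rule range_eqI[of _ _ 0]) simp
      fix s t assume "s \<in> range (\<lambda>n::nat. c [^] n)" "t \<in> range (\<lambda>n::nat. c [^] n)"
      then obtain n m :: nat where "s = c [^] n" "t = c [^] m" by blast
      then have "s \<otimes> t = c [^] (n + m)" using c by (simp add: nat_pow_mult)
      then show "s \<otimes> t \<in> range (\<lambda>n::nat. c [^] n)" by (rule range_eqI)
    qed
    moreover have "c \<in> range (\<lambda>n::nat. c [^] n)"
      using c by (intro range_eqI[of _ _ "1::nat"]) simp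
    moreover have "\<zero> \<notin> range (\<lambda>n::nat. c [^] n)" using nil by (metis rangeE)
    ultimately show ?thesis by (simp add: \<A>_def)
  qed
  then have ne: "\<A> \<noteq> {}" by blast
  have "\<Union>\<C> \<in> \<A>" if ne: "\<C> \<noteq> {}" and ch: "subset.chain \<A> \<C>" for \<C>
  proof -
    have sub: "\<C> \<subseteq> \<A>" and tot: "\<And>U V. U \<in> \<C> \<Longrightarrow> V \<in> \<C> \<Longrightarrow> U \<subseteq> V \<or> V \<subseteq> U"
      using ch by (auto simp: subset_chain_def)
    have "mult_set R (\<Union>\<C>)"
    proof (intro mult_set.intro mult_set_axioms.intro is_cring)
      show "\<Union>\<C> \<subseteq> carrier R" "\<one> \<in> \<Union>\<C>"
        using sub ne by (auto simp: \<A>_def mult_set_def mult_set_axioms_def)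
      fix s t assume "s \<in> \<Union>\<C>" "t \<in> \<Union>\<C>"
      then obtain U where "U \<in> \<C>" "s \<in> U" "t \<in> U" using tot by blast
      then show "s \<otimes> t \<in> \<Union>\<C>"
        using sub by (auto simp: \<A>_def mult_set_def mult_set_axioms_def)
    qed
    then show ?thesis using sub ne by (auto simp: \<A>_def)
  qed
  with ne obtain S where S: "S \<in> \<A>" and max: "\<And>U. U \<in> \<A> \<Longrightarrow> S \<subseteq> U \<Longrightarrow> U = S"
    using subset_Zorn_nonempty[of \<A>] by blast
  interpret mult_set R S using S by (simp add: \<A>_def)
  have S0: "\<zero> \<notin> S" and cS: "c \<in> S" using S by (auto simp: \<A>_def)
  \<comment> \<open>Otherwise the products \<open>s \<otimes> a [^] n\<close> form a member of
    \<open>\<A>\<close> that contains \<open>S\<close> and \<open>a\<close>, against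
    maximality.\<close>
  have nilS: "\<exists>s\<in>S. \<exists>n::nat. s \<otimes> a [^] n = \<zero>" if a: "a \<in> carrier R" "a \<notin> S" for a
  proof (rule ccontr)
    assume H: "\<not> ?thesis"
    let ?T = "{s \<otimes> a [^] n | s n. s \<in> S \<and> (n::nat) \<in> UNIV}"
    have ST: "S \<subseteq> ?T"
    proof
      fix s assume "s \<in> S"
      then have "s = s \<otimes> a [^] (0::nat)" by simp
      then show "s \<in> ?T" using \<open>s \<in> S\<close> by blast
    qed
    have "mult_set R ?T"
    proof (intro mult_set.intro mult_set_axioms.intro is_cring)
      show "?T \<subseteq> carrier R" using a by auto
      show "\<one> \<in> ?T" using ST S_one by blast
      fix x y assume "x \<in> ?T" "y \<in> ?T"
      then obtain s t and n m :: nat where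
        xy: "x = s \<otimes> a [^] n" "y = t \<otimes> a [^] m" "s \<in> S" "t \<in> S" by blast
      then have "x \<otimes> y = (s \<otimes> t) \<otimes> (a [^] (n + m))"
        using a by (simp add: m_ac nat_pow_mult[symmetric])
      then show "x \<otimes> y \<in> ?T" using xy S_mult by blast
    qed
    moreover have "\<zero> \<notin> ?T"
    proof
      assume "\<zero> \<in> ?T"
      then obtain s and n :: nat where "s \<in> S" "s \<otimes> a [^] n = \<zero>" by auto
      then show False using H by blast
    qed
    ultimately have "?T \<in> \<A>" using ST cS by (auto simp: \<A>_def)
    then have "?T = S" using max ST by blast
    moreover have "a \<in> ?T"
    proof -
      have "a = \<one> \<otimes> a [^] (1::nat)" using a(1) by simp
      then show ?thesis using S_one by blast
    qed
    ultimately show False using a(2) by simp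
  qed
  \<comment> \<open>Together with \<open>nilS\<close> this identifies the complement of
    \<open>S\<close> with the elements that have a power killed by some element of \<open>S\<close>.
    The ideal properties are read off from this description.\<close>
  have nilS': "a \<notin> S" if "s \<in> S" "s \<otimes> a [^] n = \<zero>" for s a and n :: nat
    using that S0 S_mult[OF that(1) S_pow] by metis
  have "primeideal (carrier R - S) R"
  proof (rule primeidealI[OF _ is_cring])
    show "carrier R \<noteq> carrier R - S" using S_one by blast
    show "a \<in> carrier R - S \<or> b \<in> carrier R - S"
      if "a \<in> carrier R" "b \<in> carrier R" "a \<otimes> b \<in> carrier R - S" for a b
      using that S_mult by blast
    show "ideal (carrier R - S) R"
    proof (rule ideal_if_closed)
      fix r a assume "r \<in> carrier R" "a \<in> carrier R - S"
      then obtain s and n :: nat where s: "s \<in> S" "s \<otimes> a [^] n = \<zero>" using nilS by blast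
      have "s \<otimes> (r \<otimes> a) [^] n = r [^] n \<otimes> (s \<otimes> a [^] n)"
        using \<open>r \<in> _\<close> \<open>a \<in> _\<close> s(1) by (simp add: nat_pow_distrib m_ac)
      then have "r \<otimes> a \<notin> S" using nilS'[OF s(1)] s(2) \<open>r \<in> _\<close> by simp
      then show "r \<otimes> a \<in> carrier R - S" using \<open>r \<in> _\<close> \<open>a \<in> _\<close> by simp
    next
      fix a b assume a: "a \<in> carrier R - S" and b: "b \<in> carrier R - S"
      obtain s and n :: nat where s: "s \<in> S" "s \<otimes> a [^] n = \<zero>" using nilS a by blast
      obtain t and m :: nat where t: "t \<in> S" "t \<otimes> b [^] m = \<zero>" using nilS b by blast
      \<comment> \<open>Either \<open>i \<ge> n\<close> and \<open>s\<close> kills the power of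
        \<open>a\<close>, or \<open>n + m - i \<ge> m\<close> and \<open>t\<close> kills the power
        of \<open>b\<close>.\<close>
      have z: "(s \<otimes> t) \<otimes> (a [^] i \<otimes> b [^] (n + m - i)) = \<zero>" if "i \<le> n + m" for i
      proof (cases "n \<le> i")
        case True
        then have "a [^] i = a [^] n \<otimes> a [^] (i - n)" using a by (simp add: nat_pow_mult)
        then have "(s \<otimes> t) \<otimes> (a [^] i \<otimes> b [^] (n + m - i)) =
            (s \<otimes> a [^] n) \<otimes> (t \<otimes> a [^] (i - n) \<otimes> b [^] (n + m - i))"
          using a b s(1) t(1) by (simp add: m_ac)
        then show ?thesis using a b s t by simp
      next
        case False
        then have "b [^] (n + m - i) = b [^] m \<otimes> b [^] (n - i)" using b by (simp add: nat_pow_mult add.commute)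
        then have "(s \<otimes> t) \<otimes> (a [^] i \<otimes> b [^] (n + m - i)) =
            (t \<otimes> b [^] m) \<otimes> (s \<otimes> a [^] i \<otimes> b [^] (n - i))"
          using a b s(1) t(1) by (simp add: m_ac)
        then show ?thesis using a b s t by simp
      qed
      have "(s \<otimes> t) \<otimes> (a \<oplus> b) [^] (n + m) =
          (\<Oplus>i\<in>{..n + m}. (s \<otimes> t) \<otimes> add_pow R ((n + m) choose i) (a [^] i \<otimes> b [^] (n + m - i)))"
        using a b s(1) t(1) by (simp add: binomial_expansion finsum_rdistr)
      also have "\<dots> = (\<Oplus>i\<in>{..n + m}. \<zero>)"
        using a b s(1) t(1) z by (intro finsum_cong') (auto simp: add_pow_rdistr)
      finally have "(s \<otimes> t) \<otimes> (a \<oplus> b) [^] (n + m) = \<zero>" by simp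
      then show "a \<oplus> b \<in> carrier R - S"
        using nilS'[OF S_mult[OF s(1) t(1)]] a b by blast
    qed (use S0 in auto)
  qed
  moreover have "\<exists>s\<in>carrier R - (carrier R - S). \<exists>n::nat. s \<otimes> a [^] n = \<zero>"
    if "a \<in> carrier R - S" for a
    using nilS that S_sub by blast
  ultimately show ?thesis using that cS by blast
qed

section \<open>Coordinates over the subring of p-th powers\<close>

context char_p_ring
begin

text \<open>Coefficients from the subring of \<open>p\<close>-th powers are represented by
  \<open>p\<close>-th roots, so that coordinates live in \<open>R\<close> and can be tested for
  membership in ideals of \<open>R\<close>.\<close>

definition frob_combine :: "'a list \<Rightarrow> 'a list \<Rightarrow> 'a" where
  "frob_combine cs us = combine (map (\<lambda>c. c [^] p) cs) us"

lemma frob_combine_closed: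
  "set cs \<subseteq> carrier R \<Longrightarrow> set us \<subseteq> carrier R \<Longrightarrow> frob_combine cs us \<in> carrier R"
  unfolding frob_combine_def by (intro combine_in_carrier) auto

lemma frob_combine_simps [simp]:
  "frob_combine (c # cs) (u # us) = c [^] p \<otimes> u \<oplus> frob_combine cs us"
  "frob_combine [] us = \<zero>" "frob_combine cs [] = \<zero>"
  by (simp_all add: frob_combine_def)

lemma frob_combine_smult:
  assumes "x \<in> carrier R" "set cs \<subseteq> carrier R" "set us \<subseteq> carrier R"
  shows "x [^] p \<otimes> frob_combine cs us = frob_combine (map ((\<otimes>) x) cs) us"
proof -
  have "x [^] p \<otimes> frob_combine cs us = combine (map ((\<otimes>) (x [^] p)) (map (\<lambda>c. c [^] p) cs)) us"
    unfolding frob_combine_def using assms by (intro combine_r_distr) auto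
  also have "map ((\<otimes>) (x [^] p)) (map (\<lambda>c. c [^] p) cs) = map (\<lambda>c. c [^] p) (map ((\<otimes>) x) cs)"
    using assms by (auto simp: nat_pow_distrib subset_eq)
  finally show ?thesis by (simp add: frob_combine_def)
qed

lemma frob_combine_add:
  assumes "length cs = length us" "length ds = length us"
    "set cs \<subseteq> carrier R" "set ds \<subseteq> carrier R" "set us \<subseteq> carrier R"
  shows "frob_combine cs us \<oplus> frob_combine ds us = frob_combine (map2 (\<oplus>) cs ds) us"
proof -
  have "(a \<oplus> b) [^] p = a [^] p \<oplus> b [^] p" if "(a, b) \<in> set (zip cs ds)" for a b
    using that assms(3,4) by (intro frob_add) (auto dest: set_zip_leftD set_zip_rightD)
  then have "map2 (\<oplus>) (map (\<lambda>c. c [^] p) cs) (map (\<lambda>c. c [^] p) ds) =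
      map (\<lambda>c. c [^] p) (map2 (\<oplus>) cs ds)"
    by (auto simp: zip_map_map)
  then show ?thesis
    unfolding frob_combine_def using assms by (subst combine_add) auto
qed

lemma frob_combine_zero:
  "set us \<subseteq> carrier R \<Longrightarrow> frob_combine (replicate (length us) \<zero>) us = \<zero>"
  by (simp add: frob_combine_def combine_replicate)

end

text \<open>Uniqueness concerns the \<open>p\<close>-th powers of the coordinates: freeness gives no
  more until Frobenius is known to be injective.\<close>

locale frob_free_ring = char_p_ring R p + noetherian_ring R for R (structure) and p +
  fixes us :: "'a list"
  assumes us_carrier: "set us \<subseteq> carrier R"
    and coords_ex: "x \<in> carrier R \<Longrightarrow>
      \<exists>cs. length cs = length us \<and> set cs \<subseteq> carrier R \<and> x = frob_combine cs us"
    and coords_unique: "length cs = length us \<Longrightarrow> length ds = length us \<Longrightarrow>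
      set cs \<subseteq> carrier R \<Longrightarrow> set ds \<subseteq> carrier R \<Longrightarrow>
      frob_combine cs us = frob_combine ds us \<Longrightarrow> map (\<lambda>c. c [^] p) cs = map (\<lambda>c. c [^] p) ds"
begin

section \<open>Nilpotent elements and reducedness\<close>

lemma coords_zero:
  assumes "length cs = length us" "set cs \<subseteq> carrier R" "frob_combine cs us = \<zero>" "c \<in> set cs"
  shows "c [^] p = \<zero>"
proof -
  have "map (\<lambda>c. c [^] p) cs = map (\<lambda>c. c [^] p) (replicate (length us) \<zero>)"
    using assms by (intro coords_unique) (auto simp: frob_combine_zero us_carrier)
  moreover have "c [^] p \<in> set (map (\<lambda>c. c [^] p) cs)" using assms(4) by simp
  ultimately show ?thesis by (auto simp: set_replicate_conv_if split: if_splits)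
qed

text \<open>Take a minimal prime \<open>P\<close> avoiding a non-nilpotent coordinate
  \<open>c\<close>. The localization at \<open>P\<close> is a field, so some \<open>s\<close>
  outside \<open>P\<close> kills the nilpotent combination. By freeness the \<open>p\<close>-th
  power of \<open>s \<otimes> c\<close> is zero, which puts \<open>s \<otimes> c\<close> into
  \<open>P\<close>, a contradiction.\<close>

lemma coords_nilpotent:
  assumes reg: "regular_ring R"
    and cs: "length cs = length us" "set cs \<subseteq> carrier R" "c \<in> set cs"
    and nil: "frob_combine cs us [^] (n::nat) = \<zero>"
  shows "\<exists>m::nat. c [^] m = \<zero>"
proof (rule ccontr)
  assume H: "\<not> ?thesis"
  have c: "c \<in> carrier R" using cs by blast
  have cn: "c [^] n \<noteq> \<zero>" for n :: nat using H by blast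
  obtain P where P: "primeideal P R" "c \<notin> P"
    "\<And>a. a \<in> P \<Longrightarrow> \<exists>s\<in>carrier R - P. \<exists>n::nat. s \<otimes> a [^] n = \<zero>"
    by (rule exists_minimal_prime[OF c cn]) blast
  interpret P: primeideal P R by fact
  have "frob_combine cs us [^] n \<in> P"
    unfolding nil by (rule additive_subgroup.zero_closed[OF P.is_additive_subgroup])
  then have "frob_combine cs us \<in> P"
    using P.pow_mem_imp_mem frob_combine_closed[OF cs(2) us_carrier] by blast
  from regular_ring_minimal_prime[OF reg P(1) P(3) this]
  obtain s where s: "s \<in> carrier R" "s \<notin> P" "s \<otimes> frob_combine cs us = \<zero>" by blast
  \<comment> \<open>Only \<open>p\<close>-th powers can be moved into the coordinates, hence the
    passage from \<open>s\<close> to \<open>s [^] p\<close>.\<close>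
  have "s [^] p = s [^] (p - 1) \<otimes> s"
    using p_gt_1 nat_pow_Suc[of s "p - 1"] by (simp del: nat_pow_Suc)
  then have "s [^] p \<otimes> frob_combine cs us = s [^] (p - 1) \<otimes> (s \<otimes> frob_combine cs us)"
    using s(1) frob_combine_closed[OF cs(2) us_carrier] by (simp add: m_assoc)
  then have "frob_combine (map ((\<otimes>) s) cs) us = \<zero>"
    using s frob_combine_smult[OF s(1) cs(2) us_carrier] by simp
  then have "(s \<otimes> c) [^] p = \<zero>"
    using cs s(1) by (intro coords_zero[of "map ((\<otimes>) s) cs"]) auto
  then have "(s \<otimes> c) [^] p \<in> P"
    by (simp only: additive_subgroup.zero_closed[OF P.is_additive_subgroup])
  then have "s \<otimes> c \<in> P" by (rule P.pow_mem_imp_mem[OF m_closed[OF s(1) c]])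
  then show False using P.I_prime[OF s(1) c] s(2) P(2) by blast
qed

text \<open>The coordinates of nilpotent elements are nilpotent, so the nilradical \<open>N\<close> is contained in
  its Frobenius power; hence \<open>N\<close> is killed by one Frobenius power less than assumed.\<close>

lemma regular_imp_reduced:
  assumes reg: "regular_ring R" and x: "x \<in> carrier R" "x [^] (n::nat) = \<zero>"
  shows "x = \<zero>"
proof -
  define N where "N = {x \<in> carrier R. \<exists>n::nat. x [^] n = \<zero>}"
  define K where "K e = {x \<in> carrier R. x [^] (p ^ e) = \<zero>}" for e :: nat
  have K_ideal: "ideal (K e) R" for e unfolding K_def by (rule ideal_frob_kernel)
  have nil_le: "z [^] m = \<zero>" if "z \<in> carrier R" "z [^] k = \<zero>" "k \<le> m" for z and k m :: nat
  proof -
    have "z [^] k \<otimes> z [^] (m - k) = z [^] m" using nat_pow_mult[OF that(1), of k "m - k"] that(3) by simp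
    then show ?thesis using nat_pow_closed[OF that(1), of "m - k"] by (simp add: that(2))
  qed
  have mono: "K e \<subseteq> K e'" if "e \<le> e'" for e e'
    using that p_gt_1 unfolding K_def by (auto intro: nil_le power_increasing)
  \<comment> \<open>The Noetherian property makes the chain \<open>K\<close> stationary, which gives
    one exponent for all nilpotent elements.\<close>
  have "subset.chain {I. ideal I R} (range K)"
    unfolding subset_chain_def using K_ideal mono by (auto) (metis nat_le_linear subset_eq)
  then have "\<Union>(range K) \<in> range K" by (intro ideal_chain_is_trivial) auto
  then obtain e where e: "\<Union>(range K) = K e" by blast
  have NK: "N \<subseteq> K e"
  proof
    fix z assume "z \<in> N"
    then obtain m :: nat where m: "z \<in> carrier R" "z [^] m = \<zero>" by (auto simp: N_def)
    have "m \<le> p ^ m" using power_gt_expt[of p m] p_gt_1 by simp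
    then have "z \<in> K m" using m nil_le by (auto simp: K_def)
    then show "z \<in> K e" using e by blast
  qed
  \<comment> \<open>The descent ends at \<open>K 0\<close>, which is the zero ideal because
    \<open>p ^ 0 = 1\<close>.\<close>
  have "N \<subseteq> K e \<Longrightarrow> N \<subseteq> K 0" for e
  proof (induction e)
    case (Suc e)
    have "N \<subseteq> K e"
    proof
      fix z assume z: "z \<in> N"
      then obtain m :: nat where m: "z \<in> carrier R" "z [^] m = \<zero>" by (auto simp: N_def)
      obtain cs where cs: "length cs = length us" "set cs \<subseteq> carrier R" "z = frob_combine cs us"
        using coords_ex m(1) by blast
      \<comment> \<open>Each coordinate is nilpotent and so lies in \<open>K (Suc e)\<close>; thus
        its \<open>p\<close>-th power lies in \<open>K e\<close>, and \<open>z\<close> is a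
        combination of these powers.\<close>
      have "c [^] p \<in> K e" if c: "c \<in> set cs" for c
      proof -
        have "c \<in> N" using coords_nilpotent[OF reg cs(1,2) c] m cs c by (auto simp: N_def)
        then have "c \<in> K (Suc e)" using Suc.prems by blast
        then show ?thesis by (auto simp: K_def nat_pow_pow)
      qed
      then show "z \<in> K e"
        unfolding cs(3) frob_combine_def using us_carrier K_ideal
        by (intro combine_in_ideal) auto
    qed
    then show ?case by (rule Suc.IH)
  qed
  with NK have "N \<subseteq> K 0" by blast
  moreover have "x \<in> N" using x by (auto simp: N_def)
  ultimately show ?thesis by (auto simp: K_def)
qed

end

section \<open>Coordinates decide membership in Frobenius powers\<close>

locale reduced_frob_free_ring = frob_free_ring +
  assumes reduced: "x \<in> carrier R \<Longrightarrow> x [^] p = \<zero> \<Longrightarrow> x = \<zero>"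
begin

lemma frob_inj:
  assumes x: "x \<in> carrier R" and y: "y \<in> carrier R" and eq: "x [^] p = y [^] p"
  shows "x = y"
proof -
  have xy: "x \<ominus> y \<in> carrier R" using x y by (rule minus_closed)
  have "(x \<ominus> y) \<oplus> y = x" using x y by (simp add: a_minus_def a_assoc l_neg)
  then have "(x \<ominus> y) [^] p \<oplus> y [^] p = \<zero> \<oplus> y [^] p"
    using frob_add[OF xy y] eq y by simp
  then have "(x \<ominus> y) [^] p = \<zero>"
    using add.right_cancel[of "y [^] p" "(x \<ominus> y) [^] p" \<zero>] xy y by simp
  then have "x \<ominus> y = \<zero>" by (rule reduced[OF xy])
  then show ?thesis using x y by simp
qed

lemma coords_unique':
  assumes "length cs = length us" "length ds = length us" "set cs \<subseteq> carrier R" "set ds \<subseteq> carrier R"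
    and "frob_combine cs us = frob_combine ds us"
  shows "cs = ds"
proof -
  have "inj_on (\<lambda>c. c [^] p) (set cs \<union> set ds)"
    using frob_inj assms(3,4) by (intro inj_onI) blast
  then show ?thesis using coords_unique[OF assms] by (simp only: inj_on_map_eq_map)
qed

text \<open>The product of \<open>c [^] p\<close> with any \<open>y\<close> has as coordinates the
  multiples by \<open>c\<close> of those of \<open>y\<close>, which lie in \<open>J\<close> when
  \<open>c\<close> does. Coordinates add because Frobenius is additive.\<close>

lemma frob_power_eq:
  assumes J: "ideal J R"
  shows "frob_power R p J = {frob_combine cs us | cs. length cs = length us \<and> set cs \<subseteq> J}"
    (is "_ = ?T")
proof
  interpret J: ideal J R by fact
  have JR: "J \<subseteq> carrier R" using J.Icarr by (rule subsetI)
  have smult: "c [^] p \<otimes> y \<in> ?T" if c: "c \<in> J" and y: "y \<in> carrier R" for c y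
  proof -
    obtain ds where ds: "length ds = length us" "set ds \<subseteq> carrier R" "y = frob_combine ds us"
      using coords_ex y by blast
    have "c [^] p \<otimes> y = frob_combine (map ((\<otimes>) c) ds) us"
      using frob_combine_smult ds c us_carrier by simp
    moreover have "set (map ((\<otimes>) c) ds) \<subseteq> J" using c ds(2) by (auto intro: J.I_r_closed)
    ultimately show ?thesis using ds(1) by (intro CollectI exI[of _ "map ((\<otimes>) c) ds"]) simp
  qed
  have add: "x \<oplus> y \<in> ?T" if xy: "x \<in> ?T" "y \<in> ?T" for x y
  proof -
    obtain cs ds where c: "length cs = length us" "set cs \<subseteq> J" "x = frob_combine cs us"
      and d: "length ds = length us" "set ds \<subseteq> J" "y = frob_combine ds us"
      using xy by blast
    have "x \<oplus> y = frob_combine (map2 (\<oplus>) cs ds) us"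
      using c d JR us_carrier by (simp add: frob_combine_add)
    moreover have "set (map2 (\<oplus>) cs ds) \<subseteq> J"
      using c(2) d(2) by (auto dest: set_zip_leftD set_zip_rightD intro!: J.a_closed)
    ultimately show ?thesis using c(1) d(1) by (intro CollectI exI[of _ "map2 (\<oplus>) cs ds"]) simp
  qed
  have zero: "\<zero> \<in> ?T"
    using frob_combine_zero[OF us_carrier]
    by (intro CollectI exI[of _ "replicate (length us) \<zero>"]) auto
  \<comment> \<open>The list \<open>ys\<close> is arbitrary because multiplication by
    \<open>r\<close> replaces \<open>us\<close> by its multiples, which need not be a basis.\<close>
  have gen: "frob_combine cs ys \<in> ?T" if "set cs \<subseteq> J" "set ys \<subseteq> carrier R" for cs ys
    using that zero
  proof (induction cs ys rule: combine.induct)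
    case (1 c cs y ys)
    have "c [^] p \<otimes> y \<in> ?T" using 1 by (intro smult) auto
    moreover have "frob_combine cs ys \<in> ?T" using 1 by auto
    ultimately show ?case unfolding frob_combine_simps by (rule add)
  qed auto
  have "ideal ?T R"
  proof (rule ideal_if_closed[OF _ zero add])
    show "?T \<subseteq> carrier R" using frob_combine_closed JR us_carrier by auto
    fix r x assume r: "r \<in> carrier R" and "x \<in> ?T"
    then obtain cs where c: "length cs = length us" "set cs \<subseteq> J" "x = frob_combine cs us" by blast
    have "r \<otimes> x = x \<otimes> r" using r c JR us_carrier by (auto intro!: m_comm frob_combine_closed)
    also have "\<dots> = frob_combine cs (map (\<lambda>u. u \<otimes> r) us)"
      unfolding c(3) frob_combine_def using c(2) JR us_carrier r by (intro combine_l_distr) auto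
    also have "\<dots> \<in> ?T" by (rule gen[OF c(2)]) (use us_carrier r in auto)
    finally show "r \<otimes> x \<in> ?T" .
  qed
  then show "frob_power R p J \<subseteq> ?T"
  proof (rule frob_power_subset)
    fix x assume "x \<in> J"
    then show "x [^] p \<in> ?T" using smult[of x \<one>] by simp
  qed
  show "?T \<subseteq> frob_power R p J"
  proof
    fix x assume "x \<in> ?T"
    then obtain cs where c: "length cs = length us" "set cs \<subseteq> J" "x = frob_combine cs us" by blast
    show "x \<in> frob_power R p J"
      unfolding c(3) frob_combine_def using pow_in_frob_power[OF J] c(2) us_carrier
      by (intro combine_in_ideal frob_power_ideal J) auto
  qed
qed

text \<open>Uniqueness of coordinates turns the existence of coordinates in \<open>J\<close> into a
  test on the given ones.\<close>

lemma frob_combine_mem_frob_power_iff: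
  assumes J: "ideal J R" and cs: "length cs = length us" "set cs \<subseteq> carrier R"
  shows "frob_combine cs us \<in> frob_power R p J \<longleftrightarrow> set cs \<subseteq> J"
proof
  interpret J: ideal J R by fact
  assume "frob_combine cs us \<in> frob_power R p J"
  then obtain ds where ds: "length ds = length us" "set ds \<subseteq> J" "frob_combine cs us = frob_combine ds us"
    unfolding frob_power_eq[OF J] by blast
  then have "cs = ds" using coords_unique'[OF cs(1) ds(1) cs(2)] J.Icarr by blast
  then show "set cs \<subseteq> J" using ds(2) by simp
qed (use frob_power_eq[OF J] cs in blast)

text \<open>As \<open>\<one>\<close> need not occur in \<open>us\<close>, it is expanded with
  coordinates \<open>ds\<close>. If \<open>x [^] p\<close> is in the Frobenius power, every
  \<open>x \<otimes> d\<close> is in \<open>J\<close>, and \<open>x\<close> is a combination of the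
  elements \<open>x \<otimes> d [^] p\<close>.\<close>

lemma pow_mem_frob_power_iff:
  assumes J: "ideal J R" and x: "x \<in> carrier R"
  shows "x [^] p \<in> frob_power R p J \<longleftrightarrow> x \<in> J"
proof
  interpret J: ideal J R by fact
  obtain ds where ds: "length ds = length us" "set ds \<subseteq> carrier R" "\<one> = frob_combine ds us"
    using coords_ex one_closed by blast
  assume "x [^] p \<in> frob_power R p J"
  moreover have "x [^] p = frob_combine (map ((\<otimes>) x) ds) us"
    using frob_combine_smult[OF x ds(2) us_carrier] x by (simp flip: ds(3))
  ultimately have xd: "set (map ((\<otimes>) x) ds) \<subseteq> J"
    using frob_combine_mem_frob_power_iff[OF J, of "map ((\<otimes>) x) ds"] ds x by auto
  have "x \<otimes> d [^] p \<in> J" if "d \<in> set ds" for d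
  proof -
    have d: "d \<in> carrier R" using that ds by blast
    have "x \<otimes> d [^] p = (x \<otimes> d) \<otimes> d [^] (p - 1)"
      using p_gt_1 x d nat_pow_Suc2[of d "p - 1"] by (simp add: m_assoc)
    then show ?thesis using xd that d by (auto intro: J.I_r_closed)
  qed
  then have "combine (map ((\<otimes>) x) (map (\<lambda>c. c [^] p) ds)) us \<in> J"
    using us_carrier by (intro combine_in_ideal J) auto
  moreover have "x \<otimes> frob_combine ds us = combine (map ((\<otimes>) x) (map (\<lambda>c. c [^] p) ds)) us"
    unfolding frob_combine_def using x ds us_carrier by (intro combine_r_distr) auto
  ultimately show "x \<in> J" using x by (simp flip: ds(3))
qed (rule pow_in_frob_power[OF J])

text \<open>This keeps the Frobenius roots in the definition of the test ideal constant as the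
  exponent grows.\<close>

lemma pow_pow_mem_frob_power_iff:
  assumes J: "ideal J R" and x: "x \<in> carrier R"
  shows "x [^] (p ^ m) \<in> frob_power R (p ^ (e + m)) J \<longleftrightarrow> x \<in> frob_power R (p ^ e) J"
proof (induction m)
  case (Suc m)
  have "x [^] (p ^ Suc m) = (x [^] (p ^ m)) [^] p"
    using x by (simp add: nat_pow_pow mult.commute)
  moreover have "frob_power R (p ^ (e + Suc m)) J = frob_power R p (frob_power R (p ^ (e + m)) J)"
    using frob_power_frob_power[OF J] by (simp add: mult.commute)
  ultimately show ?case
    using pow_mem_frob_power_iff[OF frob_power_ideal[OF J]] x Suc.IH by simp
qed (use x in simp)

end

section \<open>Ideals as test ideals\<close>

context reduced_frob_free_ring
begin

section \<open>Rank at least two: packing elements into coordinates\<close>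

lemma exists_two_mem_iff:
  assumes us: "length us \<ge> 2" and z: "z1 \<in> carrier R" "z2 \<in> carrier R"
  shows "\<exists>f\<in>carrier R. \<forall>J. ideal J R \<longrightarrow> (f \<in> frob_power R p J \<longleftrightarrow> z1 \<in> J \<and> z2 \<in> J)"
proof -
  \<comment> \<open>The zeros fill up the list; lying in every ideal, they impose no
    condition.\<close>
  define cs where "cs = z1 # z2 # replicate (length us - 2) \<zero>"
  have cs: "length cs = length us" "set cs \<subseteq> carrier R"
    using us z by (auto simp: cs_def)
  have "frob_combine cs us \<in> frob_power R p J \<longleftrightarrow> z1 \<in> J \<and> z2 \<in> J" if J: "ideal J R" for J
  proof -
    have "\<zero> \<in> J"
      using J by (intro additive_subgroup.zero_closed ideal.axioms(1))
    then show ?thesis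
      unfolding frob_combine_mem_frob_power_iff[OF J cs] by (auto simp: cs_def)
  qed
  then show ?thesis using frob_combine_closed[OF cs(2) us_carrier] by blast
qed

text \<open>Each induction step packs two elements of level \<open>e\<close> into one of level
  \<open>Suc e\<close>, because Frobenius powers compose.\<close>

lemma exists_mem_frob_power_iff:
  assumes us: "length us \<ge> 2" and "\<And>i. i \<le> e \<Longrightarrow> z i \<in> carrier R"
  shows "\<exists>f\<in>carrier R. \<forall>J. ideal J R \<longrightarrow> (f \<in> frob_power R (p ^ e) J \<longleftrightarrow> (\<forall>i\<le>e. z i \<in> J))"
  using assms(2)
proof (induction e arbitrary: z)
  case 0
  then show ?case using frob_power_one by (intro bexI[of _ "z 0"]) auto
next
  case (Suc e)
  obtain f1 where f1: "f1 \<in> carrier R"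
    "\<And>J. ideal J R \<Longrightarrow> f1 \<in> frob_power R (p ^ e) J \<longleftrightarrow> (\<forall>i\<le>e. z i \<in> J)"
    using Suc.IH[of z] Suc.prems by fastforce
  \<comment> \<open>The constant family lifts the single element \<open>z (Suc e)\<close> to the
    same level as \<open>f1\<close>.\<close>
  obtain f2 where f2: "f2 \<in> carrier R"
    "\<And>J. ideal J R \<Longrightarrow> f2 \<in> frob_power R (p ^ e) J \<longleftrightarrow> z (Suc e) \<in> J"
    using Suc.IH[of "\<lambda>_. z (Suc e)"] Suc.prems by fastforce
  obtain f where f: "f \<in> carrier R"
    "\<And>J. ideal J R \<Longrightarrow> f \<in> frob_power R p J \<longleftrightarrow> f1 \<in> J \<and> f2 \<in> J"
    using exists_two_mem_iff[OF us f1(1) f2(1)] by blast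
  have "f \<in> frob_power R (p ^ Suc e) J \<longleftrightarrow> (\<forall>i\<le>Suc e. z i \<in> J)" if J: "ideal J R" for J
  proof -
    have "frob_power R (p ^ Suc e) J = frob_power R p (frob_power R (p ^ e) J)"
      using frob_power_frob_power[OF J, of "p ^ e"] by (simp add: mult.commute)
    then show ?thesis
      using f(2)[OF frob_power_ideal[OF J]] f1(2)[OF J] f2(2)[OF J] by (auto simp: le_Suc_eq)
  qed
  then show ?case using f(1) by blast
qed

section \<open>Rank at most one: every ideal is principal\<close>

lemma frob_surj:
  assumes us: "length us < 2" and x: "x \<in> carrier R"
  shows "\<exists>y\<in>carrier R. y [^] p = x"
proof (cases us)
  case Nil
  then have "x = \<zero> [^] p" using coords_ex[OF x] by auto
  then show ?thesis by blast
next
  case (Cons u vs)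
  then have uv: "us = [u]" using us by simp
  have u: "u \<in> carrier R" using us_carrier uv by simp
  have coord: "\<exists>c\<in>carrier R. y = c [^] p \<otimes> u" if y: "y \<in> carrier R" for y
  proof -
    obtain cs where cs: "length cs = length us" "set cs \<subseteq> carrier R" "y = frob_combine cs us"
      using coords_ex[OF y] by blast
    then obtain c where "cs = [c]" by (auto simp: uv length_Suc_conv)
    then show ?thesis using cs u by (auto simp: uv)
  qed
  \<comment> \<open>This makes the basis element \<open>u\<close> a unit. Expanding
    \<open>x \<otimes> u\<close> instead of \<open>x\<close> then lets \<open>u\<close> cancel,
    leaving \<open>x = b [^] p\<close>.\<close>
  obtain c where c: "c \<in> carrier R" "\<one> = c [^] p \<otimes> u" using coord[OF one_closed] by blast
  obtain b where b: "b \<in> carrier R" "x \<otimes> u = b [^] p \<otimes> u" using coord[OF m_closed[OF x u]] by blast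
  have "x = c [^] p \<otimes> (x \<otimes> u)" using c x u by (metis m_comm m_assoc nat_pow_closed r_one)
  also have "\<dots> = b [^] p \<otimes> (c [^] p \<otimes> u)" using b c(1) u by (simp add: m_lcomm)
  finally show ?thesis using b(1) by (intro bexI[of _ b]) (simp_all flip: c(2))
qed

text \<open>The ascending chain of the principal ideals of iterated \<open>p\<close>-th roots of \<open>z\<close> stabilizes.\<close>

lemma von_neumann_regular:
  assumes us: "length us < 2" and z: "z \<in> carrier R"
  shows "\<exists>a\<in>carrier R. z = a \<otimes> z \<otimes> z"
proof -
  obtain g where g: "\<And>x. x \<in> carrier R \<Longrightarrow> g x \<in> carrier R" "\<And>x. x \<in> carrier R \<Longrightarrow> g x [^] p = x"
    using frob_surj[OF us] by metis
  define r where "r n = (g ^^ n) z" for n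
  have r: "r n \<in> carrier R" for n by (induction n) (simp_all add: r_def z g)
  have r_Suc: "r (Suc n) [^] p = r n" for n using g(2)[OF r[of n]] by (simp add: r_def)
  have r_pow: "r n [^] (p ^ n) = z" for n
  proof (induction n)
    case (Suc n)
    have "r (Suc n) [^] (p ^ Suc n) = (r (Suc n) [^] p) [^] (p ^ n)"
      using r by (simp add: nat_pow_pow)
    then show ?case using Suc.IH by (simp add: r_Suc)
  qed (simp add: r_def z)
  have step: "PIdl (r n) \<subseteq> PIdl (r (Suc n))" for n
  proof (rule cgenideal_minimal[OF cgenideal_ideal[OF r]])
    have "r n = r (Suc n) [^] (p - 1) \<otimes> r (Suc n)"
      using r_Suc[of n] p_gt_1 nat_pow_Suc[of "r (Suc n)" "p - 1"] by (simp del: nat_pow_Suc)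
    then show "r n \<in> PIdl (r (Suc n))" unfolding cgenideal_def using r by blast
  qed
  have mono: "PIdl (r m) \<subseteq> PIdl (r n)" if "m \<le> n" for m n
    using lift_Suc_mono_le[of "\<lambda>n. PIdl (r n)", OF step that] .
  have "\<Union>(range (\<lambda>n. PIdl (r n))) \<in> range (\<lambda>n. PIdl (r n))"
  proof (rule ideal_chain_is_trivial)
    have "PIdl (r m) \<subseteq> PIdl (r n) \<or> PIdl (r n) \<subseteq> PIdl (r m)" for m n
      using mono nat_le_linear by blast
    then show "subset.chain {I. ideal I R} (range (\<lambda>n. PIdl (r n)))"
      unfolding subset_chain_def using cgenideal_ideal[OF r] by auto
  qed simp
  then obtain n where "\<Union>(range (\<lambda>n. PIdl (r n))) = PIdl (r n)" by (elim rangeE)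
  then have "r (Suc n) \<in> PIdl (r n)" using cgenideal_self[OF r[of "Suc n"]] by blast
  then obtain a where a: "a \<in> carrier R" "r (Suc n) = a \<otimes> r n" unfolding cgenideal_def by blast
  obtain k where k: "p = Suc (Suc k)"
    using less_imp_Suc_add[OF p_gt_1] by auto
  have zp: "z [^] p = z [^] k \<otimes> z \<otimes> z" by (simp add: k)
  \<comment> \<open>Raising \<open>r (Suc n) = a \<otimes> r n\<close> to the power
    \<open>p ^ Suc n\<close> gives a multiple of \<open>z [^] p\<close>, which is a multiple of
    \<open>z \<otimes> z\<close> since \<open>p\<close> is at least 2.\<close>
  have "z = (a \<otimes> r n) [^] (p ^ Suc n)" using r_pow[of "Suc n"] unfolding a(2) by (rule sym)
  also have "\<dots> = a [^] (p ^ Suc n) \<otimes> (r n [^] (p ^ n)) [^] p"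
    using a(1) r[of n] by (simp only: nat_pow_distrib nat_pow_pow nat_pow_closed power_Suc mult.commute[of p])
  also have "\<dots> = (a [^] (p ^ Suc n) \<otimes> z [^] k) \<otimes> z \<otimes> z"
    unfolding r_pow zp using nat_pow_closed[OF a(1)] nat_pow_closed[OF z] z
    by (simp only: m_assoc m_closed nat_pow_closed)
  finally show ?thesis
    by (rule bexI[OF _ m_closed[OF nat_pow_closed[OF a(1)] nat_pow_closed[OF z]]])
qed

text \<open>Finitely many generators are merged two at a time, with the help of an idempotent that
  von Neumann regularity provides.\<close>

lemma ideal_principal:
  assumes us: "length us < 2" and I: "ideal I R"
  shows "\<exists>f\<in>carrier R. I = PIdl f"
proof -
  interpret I: ideal I R by fact
  have two: "\<exists>h\<in>I. f \<in> PIdl h \<and> z \<in> PIdl h" if fz: "f \<in> I" "z \<in> I" for f z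
  proof -
    have f: "f \<in> carrier R" and z: "z \<in> carrier R" using fz I.Icarr by auto
    obtain a where a: "a \<in> carrier R" "f = a \<otimes> f \<otimes> f" using von_neumann_regular[OF us f] by blast
    \<comment> \<open>An idempotent generating the same ideal as \<open>f\<close>.\<close>
    define e where "e = a \<otimes> f"
    have e: "e \<in> carrier R" "e \<otimes> f = f"
      using a(1) f a(2)[symmetric] by (simp_all only: e_def m_closed)
    have ee: "e \<otimes> e = e"
    proof -
      have "e \<otimes> e = a \<otimes> (e \<otimes> f)" unfolding e_def using a(1) f by (simp add: m_ac)
      then show ?thesis unfolding e(2) by (simp add: e_def)
    qed
    \<comment> \<open>The part of \<open>z\<close> annihilated by \<open>e\<close> is added to
      \<open>f\<close>, so multiplication by \<open>e\<close> recovers \<open>f\<close> from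
      \<open>h\<close>, and then \<open>z\<close> is recovered as well.\<close>
    define h where "h = f \<oplus> (z \<ominus> e \<otimes> z)"
    have "e \<otimes> (z \<ominus> e \<otimes> z) = e \<otimes> z \<ominus> (e \<otimes> e) \<otimes> z"
      using e(1) z by (simp add: a_minus_def r_distr r_minus m_assoc)
    then have ez: "e \<otimes> (z \<ominus> e \<otimes> z) = \<zero>" unfolding ee using e(1) z by simp
    have d: "z \<ominus> e \<otimes> z \<in> carrier R" using e(1) z by simp
    have "h \<in> I"
      unfolding h_def a_minus_def using fz e(1)
      by (intro I.a_closed I.a_inv_closed I.I_l_closed)
    have h: "h \<in> carrier R" using f d by (simp add: h_def)
    have fh: "f = e \<otimes> h"
      using f d e ez by (simp add: h_def r_distr)
    interpret H: ideal "PIdl h" R by (rule cgenideal_ideal[OF h])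
    have hH: "h \<in> PIdl h" by (rule cgenideal_self[OF h])
    have fH: "f \<in> PIdl h" using H.I_l_closed[OF hH e(1)] by (simp flip: fh)
    have "z = (h \<ominus> f) \<oplus> (a \<otimes> z) \<otimes> f"
    proof -
      have "h \<ominus> f = z \<ominus> e \<otimes> z" unfolding h_def using f d by algebra
      moreover have "(a \<otimes> z) \<otimes> f = e \<otimes> z" unfolding e_def using a(1) f z by (simp add: m_ac)
      ultimately show ?thesis using e(1) z by algebra
    qed
    moreover have "(h \<ominus> f) \<oplus> (a \<otimes> z) \<otimes> f \<in> PIdl h"
      unfolding a_minus_def using hH fH a(1) z
      by (intro H.a_closed H.a_inv_closed H.I_l_closed) simp_all
    ultimately show ?thesis using fH \<open>h \<in> I\<close> by auto
  qed
  have fin: "\<exists>f\<in>I. A \<subseteq> PIdl f" if "finite A" "A \<subseteq> I" for A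
    using that
  proof (induction A rule: finite_induct)
    case empty
    then show ?case using I.zero_closed by blast
  next
    case (insert z A)
    then obtain f where f: "f \<in> I" "A \<subseteq> PIdl f" by blast
    obtain h where h: "h \<in> I" "f \<in> PIdl h" "z \<in> PIdl h" using two[OF f(1)] insert.prems by blast
    have "PIdl f \<subseteq> PIdl h" by (rule cgenideal_minimal[OF cgenideal_ideal[OF I.Icarr[OF h(1)]] h(2)])
    then show ?case using f h by blast
  qed
  obtain A where A: "A \<subseteq> carrier R" "finite A" "I = Idl A" using finetely_gen[OF I] by blast
  then obtain f where f: "f \<in> I" "A \<subseteq> PIdl f" using fin[of A] genideal_self[OF A(1)] by blast
  have fR: "f \<in> carrier R" using f(1) by (rule I.Icarr)
  have "I \<subseteq> PIdl f" unfolding A(3) by (rule genideal_minimal[OF cgenideal_ideal[OF fR] f(2)])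
  moreover have "PIdl f \<subseteq> I" by (rule cgenideal_minimal[OF I f(1)])
  ultimately show ?thesis using fR by blast
qed

text \<open>In other words, \<open>I\<close> is the Frobenius root of level \<open>e\<close> of the
  principal ideal of \<open>f\<close>.\<close>

lemma exists_mem_frob_power_iff_subset:
  assumes I: "ideal I R"
  shows "\<exists>f\<in>carrier R. \<exists>e. \<forall>J. ideal J R \<longrightarrow> (f \<in> frob_power R (p ^ e) J \<longleftrightarrow> I \<subseteq> J)"
proof (cases "length us < 2")
  case True
  then obtain f where f: "f \<in> carrier R" "I = PIdl f" using ideal_principal[OF _ I] by blast
  \<comment> \<open>A generator itself works at level \<open>0\<close>, where the Frobenius power of
    \<open>J\<close> is \<open>J\<close>.\<close>
  have "f \<in> frob_power R (p ^ 0) J \<longleftrightarrow> I \<subseteq> J" if J: "ideal J R" for J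
    using cgenideal_self[OF f(1)] cgenideal_minimal[OF J, of f] frob_power_one[OF J] f(2) by auto
  then show ?thesis using f(1) by blast
next
  case False
  obtain A where A: "A \<subseteq> carrier R" "finite A" "I = Idl A" using finetely_gen[OF I] by blast
  obtain zs where zs: "set zs = A" using finite_list[OF A(2)] by blast
  \<comment> \<open>The bound \<open>i \<le> length zs\<close> exceeds the list by one index. The
    default \<open>\<zero>\<close> there lies in every ideal, and it also covers an empty
    list.\<close>
  define z where "z i = (if i < length zs then zs ! i else \<zero>)" for i
  have z: "z i \<in> carrier R" for i using zs A(1) nth_mem by (auto simp: z_def)
  obtain f where f: "f \<in> carrier R"
    "\<And>J. ideal J R \<Longrightarrow> f \<in> frob_power R (p ^ length zs) J \<longleftrightarrow> (\<forall>i\<le>length zs. z i \<in> J)"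
    using exists_mem_frob_power_iff[of "length zs" z] z False by auto
  have "(\<forall>i\<le>length zs. z i \<in> J) \<longleftrightarrow> I \<subseteq> J" if J: "ideal J R" for J
  proof -
    have 0: "\<zero> \<in> J" using J by (intro additive_subgroup.zero_closed ideal.axioms(1))
    have "(\<forall>i\<le>length zs. z i \<in> J) \<longleftrightarrow> (\<forall>i<length zs. zs ! i \<in> J)"
      using 0 by (auto simp: z_def)
    also have "\<dots> \<longleftrightarrow> A \<subseteq> J" using zs by (auto simp: set_conv_nth)
    also have "\<dots> \<longleftrightarrow> I \<subseteq> J" unfolding A(3) using Idl_subset_ideal[OF J A(1)] by simp
    finally show ?thesis .
  qed
  then show ?thesis using f by blast
qed

section \<open>Powers of principal ideals and the test ideal\<close>

lemma PIdl_pow: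
  fixes n :: nat
  assumes f: "f \<in> carrier R"
  shows "PIdl f [^]\<^bsub>ideals_set R\<^esub> n = PIdl (f [^] n)"
proof (induction n)
  case 0
  have "PIdl \<one> = carrier R" using cgenideal_eq_genideal[OF one_closed] genideal_one by simp
  then show ?case by (simp add: ideals_set_def)
next
  case (Suc n)
  have fn: "f [^] n \<in> carrier R" using f by simp
  have "(PIdl (f [^] n)) \<cdot>\<^bsub>R\<^esub> (PIdl f) = PIdl (f [^] n \<otimes> f)"
  proof
    show "(PIdl (f [^] n)) \<cdot>\<^bsub>R\<^esub> (PIdl f) \<subseteq> PIdl (f [^] n \<otimes> f)"
    proof
      interpret F: ideal "PIdl (f [^] n \<otimes> f)" R by (rule cgenideal_ideal[OF m_closed[OF fn f]])
      fix x assume "x \<in> (PIdl (f [^] n)) \<cdot>\<^bsub>R\<^esub> (PIdl f)"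
      then show "x \<in> PIdl (f [^] n \<otimes> f)"
      proof induction
        case (prod i j)
        then obtain a b where ab: "i = a \<otimes> f [^] n" "j = b \<otimes> f" "a \<in> carrier R" "b \<in> carrier R"
          unfolding cgenideal_def by blast
        have "i \<otimes> j = (a \<otimes> b) \<otimes> (f [^] n \<otimes> f)"
          unfolding ab(1,2) using ab(3,4) fn f by (simp only: m_ac m_closed)
        with m_closed[OF ab(3,4)] have "\<exists>x. i \<otimes> j = x \<otimes> (f [^] n \<otimes> f) \<and> x \<in> carrier R"
          by blast
        then show ?case unfolding cgenideal_def by simp
      qed (rule F.a_closed)
    qed
    show "PIdl (f [^] n \<otimes> f) \<subseteq> (PIdl (f [^] n)) \<cdot>\<^bsub>R\<^esub> (PIdl f)"
      using ideal_prod.prod[OF cgenideal_self[OF fn] cgenideal_self[OF f]]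
      by (intro cgenideal_minimal ideal_prod_is_ideal cgenideal_ideal fn f)
  qed
  moreover have "PIdl f [^]\<^bsub>ideals_set R\<^esub> Suc n = (PIdl (f [^] n)) \<cdot>\<^bsub>R\<^esub> (PIdl f)"
    unfolding Group.nat_pow_Suc Suc.IH by (simp only: ideals_set_def monoid.simps)
  ultimately show ?case unfolding Group.nat_pow_Suc by simp
qed

lemma test_ideal_exists:
  assumes I: "ideal I R"
  shows "\<exists>f\<in>carrier R. \<exists>c::real. c > 0 \<and> I = test_ideal R p (PIdl f) c"
proof -
  obtain f e where f: "f \<in> carrier R"
    and "\<forall>J. ideal J R \<longrightarrow> (f \<in> frob_power R (p ^ e) J \<longleftrightarrow> I \<subseteq> J)"
    using exists_mem_frob_power_iff_subset[OF I] by (elim bexE exE)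
  then have iff: "f \<in> frob_power R (p ^ e) J \<longleftrightarrow> I \<subseteq> J" if "ideal J R" for J
    using that by blast
  \<comment> \<open>With this exponent \<open>c * real (p ^ (e + m))\<close> is exactly
    \<open>p ^ m\<close>, so the ceiling has no effect from level \<open>e\<close> on.\<close>
  define c :: real where "c = 1 / real (p ^ e)"
  have p0: "real p > 0" using p_gt_1 by simp
  have root: "frob_root R (p ^ n) (PIdl f [^]\<^bsub>ideals_set R\<^esub> nat \<lceil>c * real (p ^ n)\<rceil>) = I"
    if ne: "n \<ge> e" for n
  proof -
    obtain m where n: "n = e + m" using le_Suc_ex[OF ne] by blast
    have "c * real (p ^ n) = real (p ^ m)"
      unfolding c_def n power_add of_nat_mult using p0 by simp
    then have "nat \<lceil>c * real (p ^ n)\<rceil> = p ^ m" by (simp only: ceiling_of_nat nat_int)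
    then have pw: "PIdl f [^]\<^bsub>ideals_set R\<^esub> nat \<lceil>c * real (p ^ n)\<rceil> = PIdl (f [^] (p ^ m))"
      by (simp only: PIdl_pow[OF f])
    have fm: "f [^] (p ^ m) \<in> carrier R" using f by simp
    \<comment> \<open>The ideals competing in the Frobenius root are those containing
      \<open>I\<close>, and \<open>I\<close> is the smallest of them.\<close>
    have sub: "PIdl (f [^] (p ^ m)) \<subseteq> frob_power R (p ^ n) J \<longleftrightarrow> I \<subseteq> J" if J: "ideal J R" for J
    proof -
      have "PIdl (f [^] (p ^ m)) \<subseteq> frob_power R (p ^ n) J \<longleftrightarrow> f [^] (p ^ m) \<in> frob_power R (p ^ n) J"
        using cgenideal_self[OF fm] cgenideal_minimal[OF frob_power_ideal[OF J]] by blast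
      then show ?thesis
        unfolding n pow_pow_mem_frob_power_iff[OF J f] iff[OF J] .
    qed
    show ?thesis
      unfolding pw by (rule frob_root_eqI) (unfold is_frob_root_def, use sub I in blast)
  qed
  have "test_ideal R p (PIdl f) c = I"
    by (rule test_ideal_eqI) (unfold eventually_sequentially, use root in blast)
  moreover have "c > 0" using p0 by (simp add: c_def)
  ultimately show ?thesis using f by (intro bexI[of _ f] exI[of _ c]) simp_all
qed

end

text \<open>Coordinates arise by choosing a \<open>p\<close>-th root of each coefficient. The choice
  need not be unique, but the coefficients are, which is the uniqueness the locale asks for.\<close>

lemma (in char_p_ring) frob_free_ring_if_finite_free_over:
  assumes noeth: "noetherian_ring R" and free: "finite_free_over R (power_subring R p)"
  obtains us where "frob_free_ring R p us"
proof -
  obtain us where us: "set us \<subseteq> carrier R" and ex1: "\<forall>x\<in>carrier R.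
      \<exists>!ks. length ks = length us \<and> set ks \<subseteq> power_subring R p \<and> x = combine ks us"
    using free unfolding finite_free_over_def by (elim exE conjE)
  have "frob_free_ring R p us"
  proof (intro frob_free_ring.intro frob_free_ring_axioms.intro char_p_ring_axioms noeth us)
    fix x assume "x \<in> carrier R"
    then obtain ks where ks: "length ks = length us" "set ks \<subseteq> power_subring R p" "x = combine ks us"
      using ex1_implies_ex[OF bspec[OF ex1]] by blast
    have "\<forall>k\<in>set ks. \<exists>c. c \<in> carrier R \<and> k = c [^] p"
      using ks(2) by (auto simp: power_subring_def)
    then obtain g where g: "\<And>k. k \<in> set ks \<Longrightarrow> g k \<in> carrier R \<and> k = g k [^] p" by metis
    have "map (\<lambda>c. c [^] p) (map g ks) = ks" using g by (simp add: map_idI)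
    then show "\<exists>cs. length cs = length us \<and> set cs \<subseteq> carrier R \<and> x = frob_combine cs us"
      using ks g by (intro exI[of _ "map g ks"]) (auto simp: frob_combine_def)
  next
    fix cs ds assume len: "length cs = length us" "length ds = length us"
      and C: "set cs \<subseteq> carrier R" "set ds \<subseteq> carrier R" and eq: "frob_combine cs us = frob_combine ds us"
    have x: "frob_combine cs us \<in> carrier R" by (rule frob_combine_closed[OF C(1) us])
    have pw: "set (map (\<lambda>c. c [^] p) cs) \<subseteq> power_subring R p"
      "set (map (\<lambda>c. c [^] p) ds) \<subseteq> power_subring R p"
      using C by (auto simp: power_subring_def)
    show "map (\<lambda>c. c [^] p) cs = map (\<lambda>c. c [^] p) ds"
    proof (rule ex1E[OF bspec[OF ex1 x]])
      fix ks assume "\<forall>ks'. length ks' = length us \<and> set ks' \<subseteq> power_subring R p \<and>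
          frob_combine cs us = combine ks' us \<longrightarrow> ks' = ks"
      then have "ks' = ks" if "length ks' = length us" "set ks' \<subseteq> power_subring R p"
          "frob_combine cs us = combine ks' us" for ks'
        using that by blast
      from this[OF _ pw(1)] this[OF _ pw(2)] show ?thesis
        using len eq unfolding frob_combine_def by simp
    qed
  qed
  then show ?thesis by (rule that)
qed

theorem theorem1p1:
  fixes R :: "('a, 'b) ring_scheme" and p :: nat
  assumes "Factorial_Ring.prime p"
    and "regular_ring R"
    and "has_characteristic R p"
    and "finite_free_over R (power_subring R p)"
  shows "\<forall>I. ideal I R \<longrightarrow>
    (\<exists>f\<in>carrier R. \<exists>c::real. c > 0 \<and> I = test_ideal R p (PIdl\<^bsub>R\<^esub> f) c)"
proof -
  have R: "cring R" "noetherian_ring R" using assms(2) by (auto simp: regular_ring_def)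
  interpret char_p_ring R p
    using R(1) assms(1,3) by (intro char_p_ring.intro char_p_ring_axioms.intro)
      (auto simp: has_characteristic_def)
  obtain us where "frob_free_ring R p us"
    using frob_free_ring_if_finite_free_over[OF R(2) assms(4)] by blast
  then interpret frob_free_ring R p us .
  \<comment> \<open>Reducedness is taken with exponent \<open>p\<close>, so that Frobenius has
    trivial kernel.\<close>
  interpret reduced_frob_free_ring R p us
    using regular_imp_reduced[OF assms(2)] by unfold_locales
  show ?thesis using test_ideal_exists by blast
qed

end
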